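(* There exist an absolute constant $C>0$ and, for each $\varepsilon$, a constant $C_1=C_1(\varepsilon)>0$ depending only on $\varepsilon$ such that the following holds. Let $0<\delta<1$, and let $M,A\in\mathbb{N}$ satisfy $M\ge 2^{4/\delta}$ and $A=M^\delta$. Then for every $0<\varepsilon<\min\{\frac\delta2,\frac13\}$ there exists $\mathbb{G}\subset\mathbb{A}^\infty$ with $$\mu^\infty\left(\mathbb{A}^\infty\setminus\mathbb{G}\right)\le C_1e^{-\frac{M^\varepsilon}{C}}$$ such that each Cantor measure $\nu$ arising from an element of $\mathbb{G}$ satisfies $$|\mathcal{F}\nu(\xi)|\le C|\xi|^{-\frac{\delta-\varepsilon}{2}}\quad\text{for all }\xi\in\mathbb{R}\text{ with }|\xi|\ge M^4.$$
   Context: Random Cantor sets and measures. For $M,A\in\mathbb{N}$ with $A=M^\delta$, $0<\delta<1$, let $\mathbb{A}(M,A)=\{\mathcal{A}\subset\{0,\dots,M-1\}:\mathrm{Card}(\mathcal{A})=A\}$, equipped with the uniform (normalized counting) probability measure. Define inductively $B_1=\frac1M\mathcal{A}$ with $\mathcal{A}\in\mathbb{A}(M,A)$, and for $j\ge2$, $$B_j=\bigcup_{b\in B_{j-1}}\left\{b+\frac{a}{M^j}:a\in\mathcal{A}(b)\right\},$$ where $\mathcal{A}(b)\in\mathbb{A}(M,A)$, $b\in B_{j-1}$, are independent and uniformly distributed on $\mathbb{A}(M,A)$. Thus $\mathrm{Card}(B_j)=A^j$. Set $$\mathcal{C}_j=\bigcup_{b\in B_j}\left[b,b+\frac{1}{M^j}\right],\qquad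 \mathcal{C}=\bigcap_{j=1}^\infty\mathcal{C}_j\subset[0,1].$$ Let $\nu_j$ be the Borel measure on $\mathbb{R}$ with density $\rho_j(x)=\frac{M^j}{A^j}\mathbf{1}_{\mathcal{C}_j}(x)$ with respect to Lebesgue measure. The Cantor measure $\nu$ is the weak limit of $\nu_j$ as $j\to\infty$; it is a probability measure supported on $\mathcal{C}$. Probability space. The choices made at the $j$-th iteration form the space $\mathbb{A}(M,A)^{A^{j-1}}$ (one alphabet for each of the $A^{j-1}$ elements of $B_{j-1}$, enumerated in increasing order; one alphabet if $j=1$) with the uniform probability measure $\mu_j$. Set $\mathbb{A}^\infty=\prod_{j=1}^\infty\mathbb{A}(M,A)^{A^{j-1}}$ with the product probability measure $\mu^\infty=\prod_{j=1}^\infty\mu_j$. Each element of $\mathbb{A}^\infty$ determines a Cantor set $\mathcal{C}$ and a Cantor measure $\nu$: its first component is the alphabet $\mathcal{A}$ giving $B_1=\frac1M\mathcal{A}$; for $j\ge2$, the $k$-th alphabet in its $j$-th component is taken as $\mathcal{A}(b)$ for the $k$-th smallest element $b$ of $B_{j-1}$, giving $B_j=\bigcup_{b\in B_{j-1}}\{b+\frac{a}{M^j}:a\in\mathcal{A}(b)\}$; then $\mathcal{C}=\bigcap_{j=1}^\infty\mathcal{C}_j$ with $\mathcal{C}_j=\bigcup_{b\in B_j}[b,b+\frac{1}{M^j}]$, and $\nu$ is the weak limit as $j\to\infty$ of the measures $\nu_j$ with density $\frac{M^j}{A^j}\mathbf{1}_{\mathcal{C}_j}$. Notation. The Fourier transform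 of a finite Borel measure $\nu$ on $\mathbb{R}$ is $\mathcal{F}\nu(\xi)=\frac{1}{\sqrt{2\pi}}\int_{\mathbb{R}}e^{-ix\xi}\,d\nu(x)$. *)

theory Defs
  imports "HOL-Probability.Probability"
begin

definition alphabets :: "nat \<Rightarrow> nat \<Rightarrow> nat set set" where
  "alphabets M A = {S. S \<subseteq> {0..<M} \<and> card S = A}"

text \<open>The choices made at step \<open>j \<ge> 1\<close>: one alphabet for each \<open>k < A ^ (j - 1)\<close>.\<close>

definition step_measure :: "nat \<Rightarrow> nat \<Rightarrow> nat \<Rightarrow> (nat \<Rightarrow> nat set) measure" where
  "step_measure M A j = uniform_count_measure ({..<A ^ (j - 1)} \<rightarrow>\<^sub>E alphabets M A)"

definition choice_measure :: "nat \<Rightarrow> nat \<Rightarrow> (nat \<Rightarrow> nat \<Rightarrow> nat set) measure" where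
  "choice_measure M A = (\<Pi>\<^sub>M j\<in>{1..}. step_measure M A j)"

text \<open>
  The sets \<open>B\<^sub>j\<close>, started from \<open>B\<^sub>0 = {0}\<close>. The alphabets of step \<open>j\<close> are indexed from \<open>0\<close>, and
  \<open>b\<close> receives the one whose index is the number of elements of \<open>B\<^bsub>j-1\<^esub>\<close> below \<open>b\<close>, that is,
  its position in the increasing enumeration of \<open>B\<^bsub>j-1\<^esub>\<close>.
\<close>

primrec cantor_pts :: "nat \<Rightarrow> (nat \<Rightarrow> nat \<Rightarrow> nat set) \<Rightarrow> nat \<Rightarrow> real set" where
  "cantor_pts M \<omega> 0 = {0}"
| "cantor_pts M \<omega> (Suc j) =
     (\<Union>b\<in>cantor_pts M \<omega> j.
        {b + real a / real M ^ Suc j |a. a \<in> \<omega> (Suc j) (card {b' \<in> cantor_pts M \<omega> j. b' < b})})"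

lemma cantor_pts_1: "cantor_pts M \<omega> 1 = (\<lambda>a. real a / real M) ` \<omega> 1 0"
  by (auto simp: image_def cong: conj_cong)

definition cantor_approx_set :: "nat \<Rightarrow> (nat \<Rightarrow> nat \<Rightarrow> nat set) \<Rightarrow> nat \<Rightarrow> real set" where
  "cantor_approx_set M \<omega> j = (\<Union>b\<in>cantor_pts M \<omega> j. {b .. b + 1 / real M ^ j})"

definition cantor_approx :: "nat \<Rightarrow> nat \<Rightarrow> (nat \<Rightarrow> nat \<Rightarrow> nat set) \<Rightarrow> nat \<Rightarrow> real measure" where
  "cantor_approx M A \<omega> j =
     density lborel
       (\<lambda>x. ennreal (real M ^ j / real A ^ j * indicator (cantor_approx_set M \<omega> j) x))"

text \<open>The weak limit of the measures \<open>\<nu>\<^sub>j\<close>, as a Borel probability measure on the line.\<close>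

definition cantor_measure :: "nat \<Rightarrow> nat \<Rightarrow> (nat \<Rightarrow> nat \<Rightarrow> nat set) \<Rightarrow> real measure" where
  "cantor_measure M A \<omega> =
     (THE \<nu>. real_distribution \<nu> \<and> weak_conv_m (cantor_approx M A \<omega>) \<nu>)"

definition fourier :: "real measure \<Rightarrow> real \<Rightarrow> complex" where
  "fourier \<nu> \<xi> = 1 / complex_of_real (sqrt (2 * pi)) *
     (CLINT x|\<nu>. exp (- (\<i> * complex_of_real x * complex_of_real \<xi>)))"

end

theory Submission
  imports Defs
begin

text \<open>
  Let \<open>N\<^sub>j \<subseteq> {0..<M ^ j}\<close> be the set of numerators of \<open>B\<^sub>j\<close> over \<open>M ^ j\<close>. The increment of the Fourier
  transforms from \<open>\<nu>\<^sub>j\<close> to \<open>\<nu>\<^bsub>j+1\<^esub>\<close> factors as the transform of a uniform distribution on an interval of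
  length \<open>1 / M ^ (j + 1)\<close>, times an exponential sum over \<open>N\<^bsub>j+1\<^esub>\<close> minus its mean given \<open>N\<^sub>j\<close>. Conditionally on \<open>N\<^sub>j\<close>, the
  latter is a sum of \<open>A ^ j\<close> independent centred terms, each obtained by sampling \<open>A\<close> out of \<open>M\<close>
  unimodular numbers without replacement. By Maclaurin's inequality for elementary symmetric
  functions its moment generating function is at most that of sampling with replacement, so
  the variance proxy is the number \<open>A ^ (j + 1)\<close> of points and not
  \<open>A ^ j * A\<^sup>2\<close>; this is what gives the exponent \<open>\<delta> / 2\<close> without losing powers of \<open>M\<close>.
  As the exponential sum is periodic and Lipschitz, a union bound over a grid of \<open>O(M ^ (2 * (j + 1)))\<close>
  points controls it for all frequencies at once. Deviations by a factor \<open>M powr (\<epsilon> * (j + 1) / 2)\<close> have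
  summable probabilities, and outside of them the increments add up to the claimed decay.
\<close>

section \<open>Sampling without replacement\<close>

text \<open>Double counting of pointed sets: a pair of a set \<open>S\<close> and a point
  \<open>a\<close> in it corresponds to the set \<open>R = S - {a}\<close> and the point
  \<open>a\<close> outside \<open>R\<close>.\<close>

lemma sum_subsets_Suc:
  assumes "finite U"
  shows "(\<Sum>S | S \<subseteq> U \<and> card S = Suc k. \<Sum>a\<in>S. F a S) =
         (\<Sum>R | R \<subseteq> U \<and> card R = k. \<Sum>a\<in>U - R. F a (insert a R))"
proof -
  have fin: "finite S" if "S \<subseteq> U" for S
    using that assms by (rule finite_subset)
  have "(\<Sum>S | S \<subseteq> U \<and> card S = Suc k. \<Sum>a\<in>S. F a S) =
        (\<Sum>(S, a)\<in>(SIGMA S:{S. S \<subseteq> U \<and> card S = Suc k}. S). F a S)"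
    using assms by (intro sum.Sigma) (auto dest: fin)
  also have "\<dots> = (\<Sum>(R, a)\<in>(SIGMA R:{R. R \<subseteq> U \<and> card R = k}. U - R). F a (insert a R))"
    by (rule sum.reindex_bij_witness[where i = "\<lambda>(R, a). (insert a R, a)" and j = "\<lambda>(S, a). (S - {a}, a)"])
       (auto simp: insert_absorb fin card_Diff_singleton)
  also have "\<dots> = (\<Sum>R | R \<subseteq> U \<and> card R = k. \<Sum>a\<in>U - R. F a (insert a R))"
    using assms by (intro sum.Sigma[symmetric]) (auto dest: fin)
  finally show ?thesis .
qed

definition esym :: "('a \<Rightarrow> real) \<Rightarrow> 'a set \<Rightarrow> nat \<Rightarrow> real" where
  "esym y U k = (\<Sum>S | S \<subseteq> U \<and> card S = k. \<Prod>a\<in>S. y a)"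

text \<open>Every set of \<open>Suc k\<close> elements arises once for each of its elements by
  adding that element to a \<open>k\<close>-set, hence the factor \<open>Suc k\<close>.\<close>

lemma esym_Suc:
  assumes "finite U"
  shows "real (Suc k) * esym y U (Suc k) =
         (\<Sum>R | R \<subseteq> U \<and> card R = k. (\<Prod>a\<in>R. y a) * (\<Sum>a\<in>U - R. y a))"
proof -
  have "real (Suc k) * esym y U (Suc k) =
        (\<Sum>S | S \<subseteq> U \<and> card S = Suc k. \<Sum>a\<in>S. \<Prod>a\<in>S. y a)"
    by (simp add: esym_def sum_distrib_left)
  also have "\<dots> = (\<Sum>R | R \<subseteq> U \<and> card R = k. \<Sum>a\<in>U - R. \<Prod>b\<in>insert a R. y b)"
    by (rule sum_subsets_Suc[OF assms])
  also have "\<dots> = (\<Sum>R | R \<subseteq> U \<and> card R = k. (\<Prod>a\<in>R. y a) * (\<Sum>a\<in>U - R. y a))"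
    using assms by (intro sum.cong refl) (auto simp: sum_distrib_left finite_subset mult.commute)
  finally show ?thesis .
qed

text \<open>Chebyshev's sum inequality over pairs of neighbouring subsets: moving one element
  \<open>a\<close> of a \<open>k\<close>-set \<open>S = insert a R\<close> leaves a Cauchy--Schwarz defect on the complement of \<open>R\<close>.\<close>

lemma esym_Suc_le:
  assumes U: "finite U" and y: "\<And>a. a \<in> U \<Longrightarrow> 0 \<le> y a"
  shows "real (card U) * real (Suc k) * esym y U (Suc k)
         \<le> real (card U - k) * (\<Sum>a\<in>U. y a) * esym y U k"
proof -
  have fin: "finite S" if "S \<subseteq> U" for S
    using that U by (rule finite_subset)
  have split: "(\<Sum>a\<in>U. y a) = (\<Sum>a\<in>S. y a) + (\<Sum>a\<in>U - S. y a)" if "S \<subseteq> U" for S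
    using U that by (metis add.commute sum.subset_diff)
  have cardD: "card (U - S) = card U - card S" "card S \<le> card U" if "S \<subseteq> U" for S
    using that U by (auto simp: card_Diff_subset fin card_mono)
  have "(\<Sum>S | S \<subseteq> U \<and> card S = k. (\<Prod>a\<in>S. y a) * (\<Sum>a\<in>S. \<Sum>c\<in>U - S. y c - y a)) \<le> 0"
  proof (cases k)
    case 0
    have "{S. S \<subseteq> U \<and> card S = k} = {{}}"
      using 0 fin by auto
    then show ?thesis by simp
  next
    case (Suc m)
    have "(\<Sum>S | S \<subseteq> U \<and> card S = Suc m. (\<Prod>a\<in>S. y a) * (\<Sum>a\<in>S. \<Sum>c\<in>U - S. y c - y a)) =
          (\<Sum>S | S \<subseteq> U \<and> card S = Suc m. \<Sum>a\<in>S. (\<Prod>a\<in>S. y a) * (\<Sum>c\<in>U - S. y c - y a))"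
      by (simp add: sum_distrib_left)
    also have "\<dots> = (\<Sum>R | R \<subseteq> U \<and> card R = m. \<Sum>a\<in>U - R.
                    (\<Prod>a\<in>insert a R. y a) * (\<Sum>c\<in>U - insert a R. y c - y a))"
      by (rule sum_subsets_Suc[OF U])
    also have "\<dots> \<le> 0"
    proof (rule sum_nonpos)
      fix R assume R: "R \<in> {R. R \<subseteq> U \<and> card R = m}"
      define V where "V = U - R"
      have "(\<Sum>a\<in>V. (\<Prod>a\<in>insert a R. y a) * (\<Sum>c\<in>U - insert a R. y c - y a)) =
            (\<Sum>a\<in>V. (\<Prod>b\<in>R. y b) * (y a * (\<Sum>c\<in>V. y c - y a)))"
      proof (rule sum.cong[OF refl])
        fix a assume a: "a \<in> V"
        have V: "finite V" "U - insert a R = V - {a}" using U by (auto simp: V_def)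
        \<comment> \<open>The term \<open>c = a\<close> vanishes, so the inner sum may run over all
          of \<open>V\<close>.\<close>
        have "(\<Sum>c\<in>V. y c - y a) = (y a - y a) + (\<Sum>c\<in>V - {a}. y c - y a)"
          using V a by (subst sum.remove[of V a]) auto
        moreover have "(\<Prod>a\<in>insert a R. y a) = y a * (\<Prod>b\<in>R. y b)"
          using a R by (subst prod.insert) (auto simp: V_def fin)
        ultimately show "(\<Prod>a\<in>insert a R. y a) * (\<Sum>c\<in>U - insert a R. y c - y a) =
            (\<Prod>b\<in>R. y b) * (y a * (\<Sum>c\<in>V. y c - y a))"
          by (simp add: V)
      qed
      also have "\<dots> = (\<Prod>b\<in>R. y b) * (\<Sum>a\<in>V. y a * (\<Sum>c\<in>V. y c) - card V * (y a)\<^sup>2)"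
        unfolding sum_distrib_left[symmetric]
        by (simp add: sum_subtractf power2_eq_square right_diff_distrib mult.left_commute)
      also have "\<dots> = (\<Prod>b\<in>R. y b) * ((\<Sum>a\<in>V. y a)\<^sup>2 - card V * (\<Sum>a\<in>V. (y a)\<^sup>2))"
        by (simp only: sum_subtractf sum_distrib_left[symmetric] sum_distrib_right[symmetric] power2_eq_square)
      also have "\<dots> \<le> 0"
      proof (rule mult_nonneg_nonpos)
        show "0 \<le> (\<Prod>b\<in>R. y b)" using R y by (intro prod_nonneg) auto
        show "(\<Sum>a\<in>V. y a)\<^sup>2 - card V * (\<Sum>a\<in>V. (y a)\<^sup>2) \<le> 0"
          using Cauchy_Schwarz_ineq_sum[of "\<lambda>_. 1" y V] by simp
      qed
      finally show "(\<Sum>a\<in>U - R. (\<Prod>a\<in>insert a R. y a) * (\<Sum>c\<in>U - insert a R. y c - y a)) \<le> 0"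
        by (simp add: V_def)
    qed
    finally show ?thesis using Suc by simp
  qed
  \<comment> \<open>The sum just shown to be nonpositive is exactly the left side of the claim minus
    the right side.\<close>
  moreover have "(\<Sum>S | S \<subseteq> U \<and> card S = k. (\<Prod>a\<in>S. y a) * (\<Sum>a\<in>S. \<Sum>c\<in>U - S. y c - y a)) =
    real (card U) * real (Suc k) * esym y U (Suc k) - real (card U - k) * (\<Sum>a\<in>U. y a) * esym y U k"
  proof -
    have "(\<Prod>a\<in>S. y a) * (\<Sum>a\<in>S. \<Sum>c\<in>U - S. y c - y a) =
        real (card U) * ((\<Prod>a\<in>S. y a) * (\<Sum>a\<in>U - S. y a))
        - real (card U - k) * (\<Sum>a\<in>U. y a) * (\<Prod>a\<in>S. y a)"
      if S: "S \<subseteq> U \<and> card S = k" for S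
    proof -
      have "(\<Sum>a\<in>S. \<Sum>c\<in>U - S. y c - y a) =
          real k * (\<Sum>c\<in>U - S. y c) - real (card U - k) * (\<Sum>a\<in>S. y a)"
        using S cardD[of S] by (simp add: sum_subtractf sum_distrib_left)
      also have "\<dots> = real (card U) * (\<Sum>c\<in>U - S. y c) - real (card U - k) * (\<Sum>a\<in>U. y a)"
        using S cardD[of S] split[of S] by (simp add: of_nat_diff algebra_simps)
      finally have *: "(\<Sum>a\<in>S. \<Sum>c\<in>U - S. y c - y a) = \<dots>" .
      show ?thesis unfolding * by (simp add: algebra_simps)
    qed
    then have "(\<Sum>S | S \<subseteq> U \<and> card S = k. (\<Prod>a\<in>S. y a) * (\<Sum>a\<in>S. \<Sum>c\<in>U - S. y c - y a)) =
      (\<Sum>S | S \<subseteq> U \<and> card S = k. real (card U) * ((\<Prod>a\<in>S. y a) * (\<Sum>a\<in>U - S. y a))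
        - real (card U - k) * (\<Sum>a\<in>U. y a) * (\<Prod>a\<in>S. y a))"
      by (intro sum.cong) auto
    also have "\<dots> = real (card U) * (real (Suc k) * esym y U (Suc k))
        - real (card U - k) * (\<Sum>a\<in>U. y a) * esym y U k"
      unfolding esym_Suc[OF U] by (simp add: esym_def sum_subtractf sum_distrib_left)
    finally show ?thesis by (simp add: mult.assoc)
  qed
  ultimately show ?thesis by simp
qed

text \<open>Iterates \<open>esym_Suc_le\<close>: passing from \<open>k\<close> to
  \<open>Suc k\<close> costs the mean of \<open>y\<close> times \<open>(card U - k) / Suc k\<close>,
  which is the ratio of consecutive binomial coefficients.\<close>

lemma Maclaurin_inequality:
  assumes U: "finite U" "U \<noteq> {}" and y: "\<And>a. a \<in> U \<Longrightarrow> 0 \<le> y a" and "k \<le> card U"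
  shows "esym y U k \<le> real (card U choose k) * ((\<Sum>a\<in>U. y a) / real (card U)) ^ k"
  using \<open>k \<le> card U\<close>
proof (induction k)
  case 0
  have "{S. S \<subseteq> U \<and> card S = 0} = {{}}"
    using U by (auto dest: finite_subset)
  then show ?case by (simp add: esym_def)
next
  case (Suc k)
  let ?n = "real (card U)" and ?s = "\<Sum>a\<in>U. y a"
  have n: "?n > 0" using U by (simp add: card_gt_0_iff)
  have s: "?s \<ge> 0" using y by (rule sum_nonneg)
  have "?n * (real (Suc k) * esym y U (Suc k)) \<le> real (card U - k) * ?s * esym y U k"
    using esym_Suc_le[OF U(1) y, where k = k] by (simp add: mult.assoc)
  also have "\<dots> \<le> real (card U - k) * ?s * (real (card U choose k) * (?s / ?n) ^ k)"
    using Suc s by (intro mult_left_mono) auto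
  also have "\<dots> = ?n * (real (card U - k) * real (card U choose k) * (?s / ?n) ^ Suc k)"
    using n by simp
  also have "real (card U - k) * real (card U choose k) = real (Suc k) * real (card U choose Suc k)"
  proof -
    have "(card U - k) * (card U choose k) = Suc k * (card U choose Suc k)"
      by (metis binomial_absorb_comp binomial_absorption)
    then show ?thesis by (metis of_nat_mult)
  qed
  finally have "?n * (real (Suc k) * esym y U (Suc k))
      \<le> ?n * (real (Suc k) * (real (card U choose Suc k) * (?s / ?n) ^ Suc k))"
    by (simp only: mult.assoc)
  then show ?case using n by (simp only: mult_le_cancel_left_pos of_nat_0_less_iff zero_less_Suc)
qed

text \<open>Hoeffding's lemma for the uniform distribution on \<open>U\<close>, stated with sums so
  that it fits the counting arguments below.\<close>

lemma Hoeffdings_lemma_sum: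
  fixes g :: "'a \<Rightarrow> real"
  assumes U: "finite U" "U \<noteq> {}" and g: "\<And>x. x \<in> U \<Longrightarrow> g x \<in> {a..b}" "(\<Sum>x\<in>U. g x) = 0"
    and "l > 0"
  shows "(\<Sum>x\<in>U. exp (l * g x)) \<le> real (card U) * exp (l\<^sup>2 * (b - a)\<^sup>2 / 8)"
proof -
  let ?p = "pmf_of_set U"
  interpret interval_bounded_random_variable "measure_pmf ?p" g a b
    by unfold_locales (use U g in \<open>auto simp: AE_measure_pmf_iff\<close>)
  have "measure_pmf.expectation ?p g = 0"
    using U g by (simp add: integral_pmf_of_set)
  from Hoeffdings_lemma_nn_integral_0[OF \<open>l > 0\<close> this]
  have "measure_pmf.expectation ?p (\<lambda>x. exp (l * g x)) \<le> exp (l\<^sup>2 * (b - a)\<^sup>2 / 8)"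
    using U by (subst (asm) nn_integral_eq_integral)
               (auto simp: integrable_measure_pmf_finite)
  then show ?thesis using U
    by (simp add: integral_pmf_of_set divide_le_eq card_gt_0_iff mult.commute)
qed

section \<open>Deviation of one generation from its conditional mean\<close>

lemma finite_alphabets [simp]: "finite (alphabets M A)"
  by (auto simp: alphabets_def intro: finite_subset[of _ "Pow {0..<M}"])

lemma card_alphabets: "card (alphabets M A) = M choose A"
  using n_subsets[of "{0..<M}" A] by (simp add: alphabets_def)

lemma alphabetsD:
  assumes "S \<in> alphabets M A"
  shows "finite S" "card S = A" "\<And>a. a \<in> S \<Longrightarrow> a < M"
  using assms by (auto simp: alphabets_def intro: finite_subset[of _ "{0..<M}"])

abbreviation alphabet_choices :: "nat \<Rightarrow> nat \<Rightarrow> nat \<Rightarrow> (nat \<Rightarrow> nat set) set" where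
  "alphabet_choices M A n \<equiv> {..<n} \<rightarrow>\<^sub>E alphabets M A"

lemma finite_alphabet_choices: "finite (alphabet_choices M A n)"
  by (intro finite_PiE) auto

text \<open>The exponential turns the sum over an alphabet into a product, so the left side is an
  elementary symmetric function of the weights \<open>y a\<close>. Maclaurin's inequality bounds it
  by the \<open>A\<close>-th power of the moment generating function of a single draw, to which
  Hoeffding's lemma applies.\<close>

lemma alphabet_mgf_le:
  fixes f :: "nat \<Rightarrow> real"
  assumes f: "\<And>a. a < M \<Longrightarrow> \<bar>f a\<bar> \<le> 1" and l: "l > 0" and M: "M > 0" "A \<le> M"
  shows "(\<Sum>S\<in>alphabets M A. exp (l * ((\<Sum>a\<in>S. f a) - real A * ((\<Sum>a<M. f a) / real M))))
         \<le> real (card (alphabets M A)) * exp (l\<^sup>2 / 2 * real A)"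
proof -
  define m where "m = (\<Sum>a<M. f a) / real M"
  define y where "y a = exp (l * (f a - m))" for a
  have "(\<Sum>S\<in>alphabets M A. exp (l * ((\<Sum>a\<in>S. f a) - real A * m))) = esym y {0..<M} A"
    unfolding esym_def
  proof (rule sum.cong)
    fix S assume "S \<in> {S. S \<subseteq> {0..<M} \<and> card S = A}"
    then have "finite S" "card S = A" by (auto dest: finite_subset)
    then show "exp (l * ((\<Sum>a\<in>S. f a) - real A * m)) = (\<Prod>a\<in>S. y a)"
      by (simp add: y_def exp_sum[symmetric] sum_distrib_left[symmetric] sum_subtractf)
  qed (simp add: alphabets_def)
  also have "\<dots> \<le> real (M choose A) * ((\<Sum>a<M. y a) / real M) ^ A"
    using Maclaurin_inequality[of "{0..<M}" y A] M by (simp add: y_def lessThan_atLeast0)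
  also have "\<dots> \<le> real (M choose A) * (exp (l\<^sup>2 / 2)) ^ A"
  proof (intro mult_left_mono power_mono)
    have "(\<Sum>a<M. f a - m) = 0"
      using M by (simp add: sum_subtractf m_def)
    moreover have "f a - m \<in> {-1 - m..1 - m}" if "a \<in> {..<M}" for a
      using f[of a] that by auto
    \<comment> \<open>The centred values lie in an interval of length 2, so Hoeffding's exponent
      \<open>l\<^sup>2 * 2\<^sup>2 / 8\<close> is \<open>l\<^sup>2 / 2\<close>.\<close>
    ultimately have "(\<Sum>a<M. exp (l * (f a - m))) \<le> real (card {..<M}) * exp (l\<^sup>2 * ((1 - m) - (-1 - m))\<^sup>2 / 8)"
      using M l by (intro Hoeffdings_lemma_sum) auto
    then show "(\<Sum>a<M. y a) / real M \<le> exp (l\<^sup>2 / 2)"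
      using M by (simp add: y_def divide_le_eq mult.commute)
  qed (auto simp: y_def intro!: sum_nonneg divide_nonneg_nonneg)
  also have "exp (l\<^sup>2 / 2) ^ A = exp (l\<^sup>2 / 2 * real A)"
    by (simp add: exp_of_nat_mult[symmetric] mult.commute)
  finally show ?thesis by (simp add: m_def card_alphabets)
qed

text \<open>Chernoff's method, with cardinalities in place of probabilities: an outcome in the bad
  set has exponential weight at least 1, and the total weight factors over the \<open>n\<close>
  independent alphabets.\<close>

lemma alphabet_choices_tail:
  fixes f :: "nat \<Rightarrow> nat \<Rightarrow> real"
  assumes f: "\<And>k a. k < n \<Longrightarrow> a < M \<Longrightarrow> \<bar>f k a\<bar> \<le> 1"
    and t: "t > 0" and n: "n > 0" and A: "A > 0" "A \<le> M"
  shows "real (card {x \<in> alphabet_choices M A n.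
            t * sqrt (real (n * A)) < (\<Sum>k<n. (\<Sum>a\<in>x k. f k a) - real A * ((\<Sum>a<M. f k a) / real M))})
         \<le> exp (- t\<^sup>2 / 2) * real (card (alphabet_choices M A n))"
    (is "real (card ?B) \<le> _ * real (card ?\<Omega>)")
proof -
  define s where "s = sqrt (real (n * A))"
  have s: "s > 0" "s\<^sup>2 = real n * real A" using n A by (auto simp: s_def)
  \<comment> \<open>This value minimises the exponent
    \<open>l\<^sup>2 * s\<^sup>2 / 2 - l * t * s\<close>; the minimum is
    \<open>- t\<^sup>2 / 2\<close>.\<close>
  define l where "l = t / s"
  have l: "l > 0" using s t by (simp add: l_def)
  define Z where "Z k S = (\<Sum>a\<in>S. f k a) - real A * ((\<Sum>a<M. f k a) / real M)" for k S
  have fin: "finite ?\<Omega>" by (rule finite_alphabet_choices)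
  have "real (card ?B) = (\<Sum>x\<in>?B. 1)" by simp
  also have "\<dots> \<le> (\<Sum>x\<in>?B. exp (l * ((\<Sum>k<n. Z k (x k)) - t * s)))"
    using l by (intro sum_mono) (auto simp: Z_def s_def)
  also have "\<dots> \<le> (\<Sum>x\<in>?\<Omega>. exp (l * ((\<Sum>k<n. Z k (x k)) - t * s)))"
    using fin by (intro sum_mono2) auto
  also have "\<dots> = exp (- l * t * s) * (\<Sum>x\<in>?\<Omega>. \<Prod>k<n. exp (l * Z k (x k)))"
    by (simp add: sum_distrib_left exp_sum[symmetric] exp_add[symmetric] algebra_simps)
  also have "(\<Sum>x\<in>?\<Omega>. \<Prod>k<n. exp (l * Z k (x k))) = (\<Prod>k<n. \<Sum>S\<in>alphabets M A. exp (l * Z k S))"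
    by (rule prod_sum_PiE[symmetric]) auto
  also have "\<dots> \<le> (\<Prod>k<n. real (card (alphabets M A)) * exp (l\<^sup>2 / 2 * real A))"
    using alphabet_mgf_le[of M "f k" l A for k] f l A
    by (intro prod_mono) (auto simp: Z_def intro!: sum_nonneg)
  also have "\<dots> = real (card ?\<Omega>) * exp (l\<^sup>2 / 2 * real A * real n)"
    by (simp add: card_PiE power_mult_distrib exp_of_nat_mult[symmetric] mult_ac)
  also have "l\<^sup>2 / 2 * real A * real n = t\<^sup>2 / 2"
    using s n A by (simp add: l_def power_divide field_simps)
  also have "exp (- l * t * s) * (real (card ?\<Omega>) * exp (t\<^sup>2 / 2)) = exp (- l * t * s + t\<^sup>2 / 2) * real (card ?\<Omega>)"
    by (simp only: exp_add mult_ac)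
  also have "- l * t * s + t\<^sup>2 / 2 = - t\<^sup>2 / 2"
    using s by (simp add: l_def power2_eq_square)
  finally show ?thesis by simp
qed

section \<open>Exponential sums over numerators: tail bounds at one frequency and at all
  frequencies\<close>

definition position :: "nat set \<Rightarrow> nat \<Rightarrow> nat" where
  "position N n = card {n' \<in> N. n' < n}"

lemma position_strict_mono:
  assumes "finite N" "m \<in> N" "m < n"
  shows "position N m < position N n"
  unfolding position_def using assms by (intro psubset_card_mono) auto

text \<open>Lets sums over the points of a generation be reindexed by the alphabets assigned to
  them, each alphabet being used exactly once.\<close>

lemma bij_betw_position:
  assumes "finite N"
  shows "bij_betw (position N) N {..<card N}"
proof -
  have inj: "inj_on (position N) N"
    by (rule linorder_inj_onI') (use position_strict_mono[OF assms] in force)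
  have "position N n < card N" if "n \<in> N" for n
    unfolding position_def using assms that by (intro psubset_card_mono) auto
  then have "position N ` N = {..<card N}"
    using inj by (intro card_subset_eq) (auto simp: card_image)
  with inj show ?thesis by (simp add: bij_betw_def)
qed

text \<open>\<open>deviation M A N x \<theta> / (A * card N)\<close> is the difference between the exponential sums
  of two consecutive generations, \<open>N\<close> being the earlier one and \<open>x\<close> the alphabets chosen.\<close>

definition deviation :: "nat \<Rightarrow> nat \<Rightarrow> nat set \<Rightarrow> (nat \<Rightarrow> nat set) \<Rightarrow> real \<Rightarrow> complex" where
  "deviation M A N x \<theta> =
     (\<Sum>n\<in>N. (\<Sum>a\<in>x (position N n). cis (real (M * n + a) * \<theta>))
        - of_real (real A) * ((\<Sum>a<M. cis (real (M * n + a) * \<theta>)) / of_real (real M)))"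

text \<open>Multiplication by the unimodular \<open>u\<close> selects a direction in the complex
  plane. The real part in this direction is a sum of the kind treated in
  \<open>alphabet_choices_tail\<close>, once \<open>e\<close> translates alphabet indices back into
  points of \<open>N\<close>.\<close>

lemma Re_deviation_tail:
  assumes N: "finite N" "N \<noteq> {}" and t: "t > 0" and A: "A > 0" "A \<le> M" and u: "norm u = 1"
  shows "real (card {x \<in> alphabet_choices M A (card N).
            t * sqrt (real (card N * A)) < Re (u * deviation M A N x \<theta>)})
         \<le> exp (- t\<^sup>2 / 2) * real (card (alphabet_choices M A (card N)))"
proof -
  define e where "e = inv_into N (position N)"
  define f where "f k a = Re (u * cis (real (M * e k + a) * \<theta>))" for k a
  note bij = bij_betw_position[OF N(1)]
  have e: "e (position N n) = n" if "n \<in> N" for n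
    using bij that by (auto simp: e_def bij_betw_def)
  have "\<bar>f k a\<bar> \<le> 1" for k a
    unfolding f_def using abs_Re_le_cmod[of "u * cis (real (M * e k + a) * \<theta>)"] u
    by (simp add: norm_mult)
  moreover have "Re (u * deviation M A N x \<theta>) =
      (\<Sum>k<card N. (\<Sum>a\<in>x k. f k a) - real A * ((\<Sum>a<M. f k a) / real M))" for x
  proof -
    have "(\<Sum>k<card N. (\<Sum>a\<in>x k. f k a) - real A * ((\<Sum>a<M. f k a) / real M)) =
      (\<Sum>n\<in>N. (\<Sum>a\<in>x (position N n). f (position N n) a) - real A * ((\<Sum>a<M. f (position N n) a) / real M))"
      by (rule sum.reindex_bij_betw[OF bij, symmetric])
    also have "\<dots> = Re (u * deviation M A N x \<theta>)"
      unfolding deviation_def sum_distrib_left Re_sum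
    proof (rule sum.cong[OF refl])
      fix n assume "n \<in> N"
      have "u * ((\<Sum>a\<in>x (position N n). cis (real (M * n + a) * \<theta>))
          - of_real (real A) * ((\<Sum>a<M. cis (real (M * n + a) * \<theta>)) / of_real (real M))) =
        (\<Sum>a\<in>x (position N n). u * cis (real (M * n + a) * \<theta>))
          - of_real (real A / real M) * (\<Sum>a<M. u * cis (real (M * n + a) * \<theta>))"
        by (simp add: sum_distrib_left[symmetric] algebra_simps)
      then show "(\<Sum>a\<in>x (position N n). f (position N n) a) - real A * ((\<Sum>a<M. f (position N n) a) / real M) =
        Re (u * ((\<Sum>a\<in>x (position N n). cis (real (M * n + a) * \<theta>))
          - of_real (real A) * ((\<Sum>a<M. cis (real (M * n + a) * \<theta>)) / of_real (real M))))"
        unfolding f_def e[OF \<open>n \<in> N\<close>] by (simp only: minus_complex.sel Re_sum Re_complex_of_real Im_complex_of_real times_complex.sel) simp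
    qed
    finally show ?thesis ..
  qed
  ultimately show ?thesis
    using alphabet_choices_tail[of "card N" M f t A] N t A by (simp add: card_gt_0_iff)
qed

lemma norm_le_2_if_Re_le:
  assumes "Re z \<le> c" "Re (- z) \<le> c" "Re (\<i> * z) \<le> c" "Re (- \<i> * z) \<le> c"
  shows "norm z \<le> 2 * c"
  using cmod_le[of z] assms by auto

text \<open>Union bound over the four directions \<open>1\<close>, \<open>-1\<close>,
  \<open>\<i>\<close> and \<open>-\<i>\<close>: a large modulus forces a large real part in one of
  them. This costs a factor 2 in the threshold and 4 in the probability.\<close>

lemma deviation_tail:
  assumes N: "finite N" "N \<noteq> {}" and t: "t > 0" and A: "A > 0" "A \<le> M"
  shows "real (card {x \<in> alphabet_choices M A (card N).
            2 * t * sqrt (real (card N * A)) < norm (deviation M A N x \<theta>)})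
         \<le> 4 * exp (- t\<^sup>2 / 2) * real (card (alphabet_choices M A (card N)))"
proof -
  let ?\<Omega> = "alphabet_choices M A (card N)"
  let ?B = "\<lambda>u. {x \<in> ?\<Omega>. t * sqrt (real (card N * A)) < Re (u * deviation M A N x \<theta>)}"
  let ?U = "{1, -1, \<i>, -\<i>}"
  have "{x \<in> ?\<Omega>. 2 * t * sqrt (real (card N * A)) < norm (deviation M A N x \<theta>)} \<subseteq> (\<Union>u\<in>?U. ?B u)"
    using norm_le_2_if_Re_le[of "deviation M A N x \<theta>" "t * sqrt (real (card N * A))" for x]
    by (fastforce simp: not_less[symmetric])
  then have "card {x \<in> ?\<Omega>. 2 * t * sqrt (real (card N * A)) < norm (deviation M A N x \<theta>)}
      \<le> card (\<Union>u\<in>?U. ?B u)"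
    by (intro card_mono) (auto simp: finite_alphabet_choices)
  also have "\<dots> \<le> (\<Sum>u\<in>?U. card (?B u))"
    by (rule card_UN_le) auto
  finally have "real (card {x \<in> ?\<Omega>. 2 * t * sqrt (real (card N * A)) < norm (deviation M A N x \<theta>)})
      \<le> real (\<Sum>u\<in>?U. card (?B u))"
    by (simp only: of_nat_le_iff)
  also have "\<dots> = (\<Sum>u\<in>?U. real (card (?B u)))" by (rule of_nat_sum)
  also have "\<dots> \<le> real (card ?U) * (exp (- t\<^sup>2 / 2) * real (card ?\<Omega>))"
  proof (rule sum_bounded_above)
    fix u assume "u \<in> ?U"
    then have "norm u = 1" by auto
    then show "real (card (?B u)) \<le> exp (- t\<^sup>2 / 2) * real (card ?\<Omega>)"
      by (rule Re_deviation_tail[OF N t A])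
  qed
  also have "\<dots> \<le> 4 * (exp (- t\<^sup>2 / 2) * real (card ?\<Omega>))"
    by (intro mult_right_mono) (auto simp: card_insert_if)
  finally show ?thesis by simp
qed

lemma dist_cis_le: "norm (cis x - cis y) \<le> \<bar>x - y\<bar>"
proof -
  have "norm (cis x - cis y) = norm (cis y * (cis (x - y) - 1))"
    by (simp add: right_diff_distrib cis_mult)
  also have "\<dots> = norm (exp (\<i> * of_real (x - y)) - 1)"
    by (simp add: norm_mult cis_conv_exp)
  also have "\<dots> \<le> \<bar>x - y\<bar>"
    using iexp_approx1[of "x - y" 0] by simp
  finally show ?thesis .
qed

text \<open>All frequencies \<open>M * n + a\<close> are at most \<open>M * L\<close>. The sampled
  sum and its mean contribute equally, whence the factor 2.\<close>

lemma deviation_Lipschitz: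
  assumes N: "finite N" "N \<subseteq> {..<L}" and x: "x \<in> alphabet_choices M A (card N)"
  shows "norm (deviation M A N x \<theta> - deviation M A N x \<theta>')
         \<le> 2 * real (card N * A) * real (M * L) * \<bar>\<theta> - \<theta>'\<bar>"
proof -
  define d where "d = real (M * L) * \<bar>\<theta> - \<theta>'\<bar>"
  define c where "c n a = cis (real (M * n + a) * \<theta>) - cis (real (M * n + a) * \<theta>')" for n a
  have c: "norm (c n a) \<le> d" if "n \<in> N" "a < M" for n a
  proof -
    have "M * n + a \<le> M * Suc n" using that by simp
    also have "\<dots> \<le> M * L" using that N by (intro mult_left_mono) auto
    finally have *: "real (M * n + a) \<le> real (M * L)" by (simp only: of_nat_le_iff)
    have "norm (c n a) \<le> real (M * n + a) * \<bar>\<theta> - \<theta>'\<bar>"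
      unfolding c_def using dist_cis_le[of "real (M * n + a) * \<theta>" "real (M * n + a) * \<theta>'"]
      by (simp add: right_diff_distrib[symmetric] abs_mult del: of_nat_add of_nat_mult)
    also have "\<dots> \<le> d" unfolding d_def using * by (intro mult_right_mono) auto
    finally show ?thesis .
  qed
  have d: "d \<ge> 0" by (simp add: d_def)
  have "deviation M A N x \<theta> - deviation M A N x \<theta>' =
     (\<Sum>n\<in>N. (\<Sum>a\<in>x (position N n). c n a) - of_real (real A) * ((\<Sum>a<M. c n a) / of_real (real M)))"
    by (simp add: deviation_def c_def sum_subtractf[symmetric] diff_divide_distrib[symmetric])
       (simp add: sum_subtractf diff_divide_distrib algebra_simps)
  also have "norm \<dots> \<le> of_nat (card N) * (2 * (real A * d))"
  proof (rule sum_norm_bound)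
    fix n assume n: "n \<in> N"
    then have "position N n < card N"
      using bij_betw_position[OF N(1)] by (auto simp: bij_betw_def)
    then have S: "x (position N n) \<in> alphabets M A" using x by auto
    have 1: "norm (\<Sum>a\<in>x (position N n). c n a) \<le> real A * d"
      using sum_norm_bound[of "x (position N n)" "c n" d] alphabetsD[OF S] c[OF n] by auto
    have "norm (\<Sum>a<M. c n a) \<le> real M * d"
      using sum_norm_bound[of "{..<M}" "c n" d] c[OF n] by auto
    then have "norm ((\<Sum>a<M. c n a) / of_real (real M)) \<le> d"
      using d by (cases "M = 0") (auto simp: norm_divide divide_le_eq mult.commute)
    then have 2: "norm (of_real (real A) * ((\<Sum>a<M. c n a) / of_real (real M))) \<le> real A * d"
      unfolding norm_mult by (intro mult_mono) auto
    show "norm ((\<Sum>a\<in>x (position N n). c n a) - of_real (real A) * ((\<Sum>a<M. c n a) / of_real (real M)))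
          \<le> 2 * (real A * d)"
      using norm_triangle_le_diff[of "\<Sum>a\<in>x (position N n). c n a"] 1 2 by (smt (verit) norm_triangle_ineq4)
  qed
  finally show ?thesis by (simp add: d_def mult_ac)
qed

lemma deviation_periodic: "deviation M A N x (\<theta> + 2 * pi * of_int k) = deviation M A N x \<theta>"
proof -
  have "cis (real n * (\<theta> + 2 * pi * of_int k)) = cis (real n * \<theta>)" for n
  proof -
    have "cis (real n * (\<theta> + 2 * pi * of_int k)) = cis (real n * \<theta>) * cis (2 * pi * of_int (int n * k))"
      by (simp add: cis_mult algebra_simps)
    also have "cis (2 * pi * of_int (int n * k)) = 1"
      by (rule cis_multiple_2pi) auto
    finally show ?thesis by simp
  qed
  then show ?thesis by (simp only: deviation_def)
qed

text \<open>By periodicity it suffices to treat one period, which is covered by a grid of mesh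
  \<open>1 / P\<^sup>2\<close> with \<open>P = M * L\<close>. The constant is 8 for the number of
  grid points over \<open>P\<^sup>2\<close>, times 4 from \<open>deviation_tail\<close>.\<close>

lemma deviation_uniform_tail:
  assumes N: "N \<noteq> {}" "N \<subseteq> {..<L}" and t: "t \<ge> 1" and A: "A > 0" "A \<le> M"
  shows "real (card {x \<in> alphabet_choices M A (card N).
            \<exists>\<theta>. 4 * t * sqrt (real (card N * A)) < norm (deviation M A N x \<theta>)})
         \<le> 32 * (real (M * L))\<^sup>2 * exp (- t\<^sup>2 / 2) * real (card (alphabet_choices M A (card N)))"
proof -
  have fin: "finite N" using N finite_subset by blast
  let ?\<Omega> = "alphabet_choices M A (card N)"
  define P where "P = real (M * L)"
  define s where "s = sqrt (real (card N * A))"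
  have cardN: "card N \<le> L" "card N > 0"
    using card_mono[OF _ N(2)] fin N by (auto simp: card_gt_0_iff)
  then have "real (card N * A) \<le> P" unfolding P_def
    using A by (simp only: of_nat_le_iff) (subst mult.commute, intro mult_mono, auto)
  moreover have P1: "P \<ge> 1"
  proof -
    have "1 \<le> M * L" using A cardN by simp
    then show ?thesis unfolding P_def by (metis of_nat_1 of_nat_le_iff)
  qed
  moreover have "P \<le> P\<^sup>2" using P1 by (intro self_le_power) auto
  ultimately have "real (card N * A) \<le> P\<^sup>2" by linarith
  then have sP: "s \<le> P" unfolding s_def using P1 by (intro real_le_lsqrt) auto
  have s2: "s * s = real (card N * A)" by (simp add: s_def)
  have s0: "s \<ge> 0" by (simp add: s_def)
  \<comment> \<open>The number 7 is a convenient bound for the period \<open>2 * pi\<close>.\<close>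
  define K where "K = nat \<lfloor>7 * P\<^sup>2\<rfloor>"
  define B where "B m = {x \<in> ?\<Omega>. 2 * t * s < norm (deviation M A N x (real m / P\<^sup>2))}" for m :: nat
  have sub: "{x \<in> ?\<Omega>. \<exists>\<theta>. 4 * t * s < norm (deviation M A N x \<theta>)} \<subseteq> (\<Union>m\<in>{..K}. B m)"
  proof safe
    fix x \<theta> assume x: "x \<in> ?\<Omega>" and big: "4 * t * s < norm (deviation M A N x \<theta>)"
    define \<theta>' where "\<theta>' = 2 * pi * frac (\<theta> / (2 * pi))"
    have "\<theta> = \<theta>' + 2 * pi * of_int \<lfloor>\<theta> / (2 * pi)\<rfloor>"
      by (simp add: \<theta>'_def frac_def algebra_simps)
    then have dev: "deviation M A N x \<theta> = deviation M A N x \<theta>'"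
      by (metis deviation_periodic)
    have \<theta>': "0 \<le> \<theta>'" "\<theta>' \<le> 7"
    proof -
      have "\<theta>' \<le> 2 * pi * 1"
        unfolding \<theta>'_def using frac_lt_1[of "\<theta> / (2 * pi)"] by (intro mult_left_mono) auto
      then show "\<theta>' \<le> 7" using pi_less_4 pi_approx by simp
    qed (simp add: \<theta>'_def)
    define m where "m = nat \<lfloor>\<theta>' * P\<^sup>2\<rfloor>"
    have "m \<le> K" unfolding m_def K_def using \<theta>'
      by (intro nat_mono floor_mono mult_right_mono) auto
    have m: "real m = of_int \<lfloor>\<theta>' * P\<^sup>2\<rfloor>" using \<theta>' by (simp add: m_def)
    have "\<bar>\<theta>' - real m / P\<^sup>2\<bar> = \<bar>\<theta>' * P\<^sup>2 - real m\<bar> / P\<^sup>2"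
      using P1 by (simp add: diff_divide_distrib[symmetric] abs_divide field_simps)
    also have "\<dots> \<le> 1 / P\<^sup>2"
      unfolding m by (intro divide_right_mono) (linarith, simp)
    finally have close: "\<bar>\<theta>' - real m / P\<^sup>2\<bar> \<le> 1 / P\<^sup>2" .
    \<comment> \<open>Moving to the grid point changes the deviation by at most
      \<open>2 * s * t\<close>, because \<open>s \<le> P\<close> and \<open>1 \<le> t\<close>. This
      is half of the threshold, and the other half remains at the grid point.\<close>
    have "norm (deviation M A N x \<theta>' - deviation M A N x (real m / P\<^sup>2))
        \<le> 2 * (s * s) * P * (1 / P\<^sup>2)"
      using deviation_Lipschitz[OF fin N(2) x, of \<theta>' "real m / P\<^sup>2"]
        mult_left_mono[OF close, of "2 * (s * s) * P"] P1 s0 by (simp add: s2 P_def)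
    also have "\<dots> = 2 * s * (s / P)"
      using P1 by (simp add: power2_eq_square)
    also have "\<dots> \<le> 2 * s * t"
      using sP P1 s0 t by (intro mult_left_mono) (auto simp: divide_le_eq intro: order_trans[of _ P] mult_right_mono[of 1 t P, simplified])
    finally have "norm (deviation M A N x \<theta>') \<le> norm (deviation M A N x (real m / P\<^sup>2)) + 2 * s * t"
      by (smt (verit) norm_triangle_ineq2)
    then have "x \<in> B m"
      using big x by (simp add: B_def dev mult_ac)
    then show "x \<in> (\<Union>m\<in>{..K}. B m)" using \<open>m \<le> K\<close> by auto
  qed
  have "card {x \<in> ?\<Omega>. \<exists>\<theta>. 4 * t * s < norm (deviation M A N x \<theta>)} \<le> card (\<Union>m\<in>{..K}. B m)"
    by (intro card_mono sub) (auto simp: B_def finite_alphabet_choices)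
  also have "\<dots> \<le> (\<Sum>m\<le>K. card (B m))" by (rule card_UN_le) auto
  finally have "real (card {x \<in> ?\<Omega>. \<exists>\<theta>. 4 * t * s < norm (deviation M A N x \<theta>)}) \<le> real (\<Sum>m\<le>K. card (B m))"
    by (simp only: of_nat_le_iff)
  also have "\<dots> = (\<Sum>m\<le>K. real (card (B m)))" by (rule of_nat_sum)
  also have "\<dots> \<le> real (card {..K}) * (4 * exp (- t\<^sup>2 / 2) * real (card ?\<Omega>))"
    unfolding B_def s_def using t by (intro sum_bounded_above deviation_tail fin N A) auto
  also have "\<dots> \<le> (8 * P\<^sup>2) * (4 * exp (- t\<^sup>2 / 2) * real (card ?\<Omega>))"
  proof (intro mult_right_mono)
    have "1 \<le> P\<^sup>2" using P1 by (simp add: one_le_power)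
    moreover have "real K \<le> 7 * P\<^sup>2" by (simp add: K_def)
    ultimately show "real (card {..K}) \<le> 8 * P\<^sup>2" by simp
  qed auto
  finally show ?thesis by (simp add: s_def P_def mult_ac)
qed

section \<open>Characteristic functions of the approximating measures\<close>

text \<open>Tightness provides a weak limit along a subsequence. Convergence of the full sequence of
  characteristic functions identifies their limit as that of this measure, and Levy's continuity
  theorem then gives weak convergence of the full sequence.\<close>

lemma tight_convergent_char_imp_weak_conv:
  assumes tight: "tight \<mu>" and conv: "\<And>t. convergent (\<lambda>n. char (\<mu> n) t)"
  obtains \<nu> where "real_distribution \<nu>" "weak_conv_m \<mu> \<nu>"
proof -
  have rd: "real_distribution (\<mu> n)" for n using tight by (simp add: tight_def)
  obtain r \<nu> where r: "strict_mono r" "real_distribution \<nu>" "weak_conv_m (\<mu> \<circ> id \<circ> r) \<nu>"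
    using tight_imp_convergent_subsubsequence[OF tight, of id] by (auto simp: strict_mono_def)
  have "(\<lambda>n. char (\<mu> n) t) \<longlonglongrightarrow> char \<nu> t" for t
  proof -
    obtain c where c: "(\<lambda>n. char (\<mu> n) t) \<longlonglongrightarrow> c" using conv by (auto simp: convergent_def)
    have "(\<lambda>n. char ((\<mu> \<circ> id \<circ> r) n) t) \<longlonglongrightarrow> char \<nu> t"
      by (rule levy_continuity1[OF _ r(2,3)]) (simp add: rd)
    moreover have "(\<lambda>n. char ((\<mu> \<circ> id \<circ> r) n) t) \<longlonglongrightarrow> c"
      using LIMSEQ_subseq_LIMSEQ[OF c r(1)] by (simp add: o_def)
    ultimately show ?thesis using c LIMSEQ_unique by blast
  qed
  then have "weak_conv_m \<mu> \<nu>" by (rule levy_continuity[OF rd r(2)])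
  with r(2) show thesis by (rule that)
qed

lemma weak_conv_m_unique:
  assumes "\<And>n. real_distribution (\<mu> n)" "real_distribution \<nu>" "real_distribution \<nu>'"
    and "weak_conv_m \<mu> \<nu>" "weak_conv_m \<mu> \<nu>'"
  shows "\<nu> = \<nu>'"
proof (rule Levy_uniqueness)
  show "char \<nu> = char \<nu>'"
    using levy_continuity1[of \<mu> \<nu>] levy_continuity1[of \<mu> \<nu>'] assms LIMSEQ_unique by blast
qed fact+

text \<open>The characteristic function of the uniform distribution on \<open>{0..1}\<close>, with
  the removable singularity at 0 filled in.\<close>

definition unit_char :: "real \<Rightarrow> complex" where
  "unit_char s = (if s = 0 then 1 else (cis s - 1) / (\<i> * of_real s))"

lemma norm_unit_char_le_1: "norm (unit_char s) \<le> 1"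
  using dist_cis_le[of s 0] by (auto simp: unit_char_def norm_divide norm_mult divide_le_eq)

lemma norm_unit_char_le: "norm (unit_char s) \<le> 2 / \<bar>s\<bar>" if "s \<noteq> 0"
  using norm_triangle_ineq4[of "cis s" 1] that
  by (auto simp: unit_char_def norm_divide norm_mult intro!: divide_right_mono)

text \<open>A uniform variable on \<open>{0..M}\<close> is the sum of independent uniform variables
  on \<open>{0..1}\<close> and on \<open>{0..<M}\<close>; analytically, this is the geometric sum.
  It expresses a cell of one generation at the scale of the next.\<close>

lemma unit_char_mult:
  assumes "M > 0"
  shows "unit_char (real M * s) = unit_char s * ((\<Sum>a<M. cis (real a * s)) / of_real (real M))"
proof (cases "s = 0")
  case False
  have "cis (real M * s) - 1 = (cis s - 1) * (\<Sum>a<M. cis (real a * s))"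
    by (simp add: Complex.DeMoivre[symmetric] power_diff_1_eq)
  then show ?thesis using False assms by (simp add: unit_char_def mult_ac)
qed (use assms in \<open>simp add: unit_char_def\<close>)

lemma integral_iexp_Icc:
  assumes "h \<ge> 0"
  shows "has_bochner_integral lborel (\<lambda>x. indicator {u..u + h} x *\<^sub>R iexp (t * x))
           (of_real h * cis (t * u) * unit_char (t * h))"
proof -
  define F where "F x = (if t = 0 then of_real x else iexp (t * x) / (\<i> * of_real t))" for x :: real
  have "has_bochner_integral lborel (\<lambda>x. indicator {u..u + h} x *\<^sub>R iexp (t * x)) (F (u + h) - F u)"
  proof (rule has_bochner_integral_FTC_Icc)
    fix x
    have "((\<lambda>x. exp (\<i> * of_real t * x)) has_field_derivative exp (\<i> * of_real t * of_real x) * (\<i> * of_real t))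
       (at (of_real x))"
      by (auto intro!: derivative_eq_intros)
    then have *: "((\<lambda>x. exp (\<i> * of_real t * of_real x)) has_vector_derivative exp (\<i> * of_real t * of_real x) * (\<i> * of_real t))
       (at x within {u..u + h})"
      by (rule has_vector_derivative_real_field)
    show "(F has_vector_derivative iexp (t * x)) (at x within {u..u + h})"
    proof (cases "t = 0")
      case True
      have "((\<lambda>x. of_real x) has_vector_derivative (1::complex)) (at x within {u..u + h})"
        by (auto intro!: derivative_eq_intros has_vector_derivative_of_real)
      then show ?thesis using True by (simp add: F_def[abs_def])
    next
      case False
      show ?thesis
        using has_vector_derivative_divide[OF *, of "\<i> * of_real t"] False
        by (simp add: F_def[abs_def] mult.assoc)
    qed
  qed (use assms in \<open>auto intro!: continuous_intros\<close>)
  moreover have "F (u + h) - F u = of_real h * cis (t * u) * unit_char (t * h)"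
    by (auto simp: F_def unit_char_def cis_conv_exp ring_distribs exp_add field_simps)
  ultimately show ?thesis by simp
qed

section \<open>The Cantor construction in integer coordinates\<close>

primrec cantor_ints :: "nat \<Rightarrow> (nat \<Rightarrow> nat \<Rightarrow> nat set) \<Rightarrow> nat \<Rightarrow> nat set" where
  "cantor_ints M \<omega> 0 = {0}"
| "cantor_ints M \<omega> (Suc j) =
     (\<Union>n\<in>cantor_ints M \<omega> j. (\<lambda>a. M * n + a) ` \<omega> (Suc j) (position (cantor_ints M \<omega> j) n))"

lemma cantor_ints_cong:
  assumes "\<And>i. 1 \<le> i \<Longrightarrow> i \<le> j \<Longrightarrow> \<omega> i = \<omega>' i"
  shows "cantor_ints M \<omega> j = cantor_ints M \<omega>' j"
  using assms by (induction j) simp_all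

text \<open>Division by \<open>M ^ j\<close> is strictly increasing, so a point and its numerator
  have the same rank in their generation and receive the same alphabet.\<close>

lemma cantor_pts_eq:
  assumes "M > 0"
  shows "cantor_pts M \<omega> j = (\<lambda>n. real n / real M ^ j) ` cantor_ints M \<omega> j"
proof (induction j)
  case (Suc j)
  let ?N = "cantor_ints M \<omega> j" and ?f = "\<lambda>n. real n / real M ^ j"
  have "{b' \<in> ?f ` ?N. b' < ?f n} = ?f ` {n' \<in> ?N. n' < n}" for n
    using assms by (auto simp: divide_less_cancel)
  moreover have "inj_on ?f X" for X
    using assms by (auto intro!: inj_onI)
  ultimately have position: "card {b' \<in> ?f ` ?N. b' < ?f n} = position ?N n" for n
    by (simp add: card_image position_def)
  have "real n / real M ^ j + real a / real M ^ Suc j = real (M * n + a) / real M ^ Suc j" for n a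
    using assms by (simp add: field_simps)
  then show ?case
    unfolding cantor_pts.simps Suc.IH
    by (auto simp: position image_UN image_image simp del: of_nat_add of_nat_mult power_Suc)
qed simp

text \<open>A single admissible outcome; the analysis inside this locale is deterministic.\<close>

locale cantor_tree =
  fixes M A :: nat and \<omega> :: "nat \<Rightarrow> nat \<Rightarrow> nat set"
  assumes A_pos: "A > 0" and A_le: "A \<le> M"
    and choices: "\<And>j. \<omega> (Suc j) \<in> alphabet_choices M A (A ^ j)"
begin

abbreviation N where "N \<equiv> cantor_ints M \<omega>"

lemma M_pos: "M > 0" using A_pos A_le by simp

text \<open>The two claims are interdependent. The sum formula for generation \<open>Suc j\<close>
  requires the cardinality of \<open>N j\<close>, so that each rank is the index of an alphabet;
  conversely the cardinality of \<open>N (Suc j)\<close> is the sum formula for the constant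
  1.\<close>

lemma N_props: "finite (N j) \<and> card (N j) = A ^ j \<and> N j \<subseteq> {..<M ^ j}"
  and sum_N_Suc: "(\<Sum>m\<in>N (Suc j). f m) = (\<Sum>n\<in>N j. \<Sum>a\<in>\<omega> (Suc j) (position (N j) n). f (M * n + a))"
    for f :: "nat \<Rightarrow> 'b::comm_monoid_add"
proof -
  have step: "\<omega> (Suc j) (position (N j) n) \<in> alphabets M A"
    if "finite (N j)" "card (N j) = A ^ j" "n \<in> N j" for j n
    using choices[of j] bij_betw_position[of "N j"] that by (auto simp: bij_betw_def)
  have sum: "(\<Sum>m\<in>N (Suc j). f m) = (\<Sum>n\<in>N j. \<Sum>a\<in>\<omega> (Suc j) (position (N j) n). f (M * n + a))"
    if fin: "finite (N j)" and card: "card (N j) = A ^ j" for j and f :: "nat \<Rightarrow> 'c::comm_monoid_add"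
  proof -
    note S = alphabetsD[OF step[OF fin card]]
    have "(\<Sum>m\<in>N (Suc j). f m) = (\<Sum>n\<in>N j. sum f ((\<lambda>a. M * n + a) ` \<omega> (Suc j) (position (N j) n)))"
      unfolding cantor_ints.simps
    proof (rule sum.UNION_disjoint)
      show "\<forall>n\<in>N j. \<forall>n'\<in>N j. n \<noteq> n' \<longrightarrow> (\<lambda>a. M * n + a) ` \<omega> (Suc j) (position (N j) n) \<inter>
         (\<lambda>a. M * n' + a) ` \<omega> (Suc j) (position (N j) n') = {}"
      proof safe
        fix n n' a a' assume *: "n \<in> N j" "n' \<in> N j" "n \<noteq> n'" "a \<in> \<omega> (Suc j) (position (N j) n)"
          "a' \<in> \<omega> (Suc j) (position (N j) n')" "M * n + a = M * n' + a'"
        \<comment> \<open>Division by \<open>M\<close> recovers the parent, so distinct parents have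
          disjoint sets of children.\<close>
        from *(6) have "(M * n + a) div M = (M * n' + a') div M" by simp
        moreover have "(M * n + a) div M = n" "(M * n' + a') div M = n'"
          using S(3)[OF *(1,4)] S(3)[OF *(2,5)] M_pos by simp_all
        ultimately have "n = n'" by simp
        with * show "M * n + a \<in> {}" by simp
      qed
    qed (use fin S in auto)
    also have "\<dots> = (\<Sum>n\<in>N j. \<Sum>a\<in>\<omega> (Suc j) (position (N j) n). f (M * n + a))"
      by (simp add: sum.reindex inj_on_def)
    finally show ?thesis .
  qed
  have props: "finite (N j) \<and> card (N j) = A ^ j \<and> N j \<subseteq> {..<M ^ j}" for j
  proof (induction j)
    case (Suc j)
    then have fin: "finite (N j)" and card: "card (N j) = A ^ j" and sub: "N j \<subseteq> {..<M ^ j}" by auto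
    note S = alphabetsD[OF step[OF fin card]]
    have "finite (N (Suc j))" using fin S by auto
    moreover have "card (N (Suc j)) = A ^ Suc j"
      using sum[OF fin card, of "\<lambda>_. 1::nat"] S(2) card by simp
    moreover have "N (Suc j) \<subseteq> {..<M ^ Suc j}"
    proof
      fix m assume "m \<in> N (Suc j)"
      then obtain n a where m: "n \<in> N j" "a \<in> \<omega> (Suc j) (position (N j) n)" "m = M * n + a" by auto
      have "m < M * Suc n" using S(3)[OF m(1,2)] m(3) by simp
      also have "\<dots> \<le> M * M ^ j" using m(1) sub by (intro mult_left_mono) auto
      finally show "m \<in> {..<M ^ Suc j}" by simp
    qed
    ultimately show ?case by blast
  qed simp
  show "finite (N j) \<and> card (N j) = A ^ j \<and> N j \<subseteq> {..<M ^ j}" by (rule props)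
  show "(\<Sum>m\<in>N (Suc j). f m) = (\<Sum>n\<in>N j. \<Sum>a\<in>\<omega> (Suc j) (position (N j) n). f (M * n + a))"
    using props by (intro sum) auto
qed

lemma finite_N: "finite (N j)" and card_N: "card (N j) = A ^ j" and N_subset: "N j \<subseteq> {..<M ^ j}"
  using N_props by auto

abbreviation cell :: "nat \<Rightarrow> nat \<Rightarrow> real set" where
  "cell j n \<equiv> {real n / real M ^ j..real n / real M ^ j + 1 / real M ^ j}"

lemma cantor_approx_set_eq: "cantor_approx_set M \<omega> j = (\<Union>n\<in>N j. cell j n)"
  by (simp add: cantor_approx_set_def cantor_pts_eq[OF M_pos])

lemma cantor_approx_set_borel [measurable]: "cantor_approx_set M \<omega> j \<in> sets borel"
  unfolding cantor_approx_set_eq using finite_N by (intro sets.finite_UN) auto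

lemma cantor_approx_set_subset: "cantor_approx_set M \<omega> j \<subseteq> {0..1}"
proof
  fix x assume "x \<in> cantor_approx_set M \<omega> j"
  then obtain n where n: "n < M ^ j" "x \<in> cell j n" using N_subset unfolding cantor_approx_set_eq by blast
  have "x \<le> real (Suc n) / real M ^ j" using n(2) by (simp add: add_divide_distrib)
  also have "\<dots> \<le> 1"
    using n(1) M_pos by (simp add: divide_le_eq) (metis Suc_leI of_nat_Suc of_nat_le_iff of_nat_power)
  finally show "x \<in> {0..1}" using n(2) by (auto intro: order_trans[rotated])
qed

text \<open>Two distinct cells of one generation can meet only in the left endpoint of the right
  one, so it is enough to discard the finitely many left endpoints.\<close>

lemma AE_indicator_cantor_approx_set:
  "AE x in lborel. (indicator (cantor_approx_set M \<omega> j) x :: real) = (\<Sum>n\<in>N j. indicator (cell j n) x)"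
proof -
  let ?E = "(\<lambda>n. real n / real M ^ j) ` N j"
  have "?E \<in> null_sets lborel" using finite_N by (intro finite_imp_null_set_lborel) auto
  then have "AE x in lborel. x \<notin> ?E" by (rule AE_not_in)
  then show ?thesis
  proof eventually_elim
    case (elim x)
    have uniq: "n = m" if "n \<in> N j" "m \<in> N j" "x \<in> cell j n" "x \<in> cell j m" for n m
      using that
    proof (induction n m rule: linorder_wlog)
      case (le n m)
      have "real m / real M ^ j < x" using elim le by force
      also have "x \<le> (real n + 1) / real M ^ j" using le by (simp add: add_divide_distrib)
      finally have "real m < real n + 1" using M_pos by (simp add: divide_less_cancel)
      with le show "n = m" by linarith
    qed auto
    show ?case
    proof (cases "x \<in> cantor_approx_set M \<omega> j")
      case True
      then obtain n where n: "n \<in> N j" "x \<in> cell j n" unfolding cantor_approx_set_eq by blast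
      have "(\<Sum>n\<in>N j. indicator (cell j n) x) = (\<Sum>m\<in>N j. if m = n then 1 else 0 :: real)"
      proof (rule sum.cong[OF refl])
        fix m assume m: "m \<in> N j"
        have "x \<in> cell j m \<longleftrightarrow> m = n" using uniq[OF m n(1) _ n(2)] n(2) by blast
        then show "indicator (cell j m) x = (if m = n then 1 else 0 :: real)"
          by (simp only: indicator_def of_bool_def)
      qed
      then show ?thesis using True n finite_N by simp
    next
      case False
      then have "x \<notin> cell j n" if "n \<in> N j" for n using that unfolding cantor_approx_set_eq by blast
      then show ?thesis using False by simp
    qed
  qed
qed

lemma char_cantor_approx:
  "char (cantor_approx M A \<omega> j) t =
     (\<Sum>n\<in>N j. cis (real n * (t / real M ^ j))) / of_real (real A ^ j) * unit_char (t / real M ^ j)"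
proof -
  let ?c = "real M ^ j / real A ^ j" and ?C = "cantor_approx_set M \<omega> j" and ?h = "1 / real M ^ j"
  have cell: "has_bochner_integral lborel (\<lambda>x. indicator (cell j n) x *\<^sub>R iexp (t * x))
     (of_real ?h * cis (real n * (t / real M ^ j)) * unit_char (t / real M ^ j))" for n
    using integral_iexp_Icc[of ?h "real n / real M ^ j" t] by (simp add: mult.commute)
  have "char (cantor_approx M A \<omega> j) t = (CLINT x|lborel. (?c * indicator ?C x) *\<^sub>R iexp (t * x))"
    unfolding char_def cantor_approx_def by (rule integral_density) auto
  also have "\<dots> = (CLINT x|lborel. ?c *\<^sub>R (\<Sum>n\<in>N j. indicator (cell j n) x *\<^sub>R iexp (t * x)))"
  proof (rule integral_cong_AE)
    show "AE x in lborel. (?c * indicator ?C x) *\<^sub>R iexp (t * x) =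
        ?c *\<^sub>R (\<Sum>n\<in>N j. indicator (cell j n) x *\<^sub>R iexp (t * x))"
      using AE_indicator_cantor_approx_set[of j]
      by eventually_elim (simp add: scaleR_sum_left[symmetric])
  qed measurable
  also have "\<dots> = ?c *\<^sub>R (\<Sum>n\<in>N j. CLINT x|lborel. indicator (cell j n) x *\<^sub>R iexp (t * x))"
    using cell[THEN integrable.intros]
    by (subst integral_scaleR_right, (subst Bochner_Integration.integral_sum)?) auto
  also have "\<dots> = ?c *\<^sub>R (\<Sum>n\<in>N j. of_real ?h * cis (real n * (t / real M ^ j)) * unit_char (t / real M ^ j))"
    by (simp only: cell[THEN has_bochner_integral_integral_eq])
  also have "\<dots> = (\<Sum>n\<in>N j. cis (real n * (t / real M ^ j))) / of_real (real A ^ j) * unit_char (t / real M ^ j)"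
    using M_pos
    by (simp add: scaleR_conv_of_real sum_distrib_left[symmetric] sum_distrib_right[symmetric]
        sum_divide_distrib[symmetric])
  finally show ?thesis .
qed

lemma real_distribution_cantor_approx: "real_distribution (cantor_approx M A \<omega> j)"
proof -
  let ?c = "real M ^ j / real A ^ j" and ?C = "cantor_approx_set M \<omega> j"
  have "emeasure (cantor_approx M A \<omega> j) UNIV = (\<integral>\<^sup>+x. ennreal (?c * indicator ?C x) \<partial>lborel)"
    unfolding cantor_approx_def by (subst emeasure_density) auto
  also have "\<dots> = (\<integral>\<^sup>+x. ennreal ?c * (\<Sum>n\<in>N j. indicator (cell j n) x) \<partial>lborel)"
  proof (rule nn_integral_cong_AE)
    show "AE x in lborel. ennreal (?c * indicator ?C x) = ennreal ?c * (\<Sum>n\<in>N j. indicator (cell j n) x)"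
      using AE_indicator_cantor_approx_set[of j]
    proof eventually_elim
      case (elim x)
      have "(\<Sum>n\<in>N j. indicator (cell j n) x :: ennreal) = ennreal (\<Sum>n\<in>N j. indicator (cell j n) x)"
        by (simp add: sum_ennreal[symmetric] ennreal_indicator)
      then show ?case unfolding elim by (simp add: ennreal_mult[symmetric] sum_nonneg)
    qed
  qed
  also have "\<dots> = ennreal ?c * (\<Sum>n\<in>N j. \<integral>\<^sup>+x. indicator (cell j n) x \<partial>lborel)"
    by (subst nn_integral_cmult, measurable) (subst nn_integral_sum, auto)
  also have "\<dots> = ennreal ?c * (\<Sum>n\<in>N j. ennreal (1 / real M ^ j))"
    by simp
  also have "\<dots> = 1"
    using M_pos A_pos by (simp add: card_N ennreal_of_nat_eq_real_of_nat ennreal_mult[symmetric])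
  finally have "prob_space (cantor_approx M A \<omega> j)"
    by (intro prob_spaceI) (simp add: cantor_approx_def)
  then show ?thesis
    by (simp add: real_distribution_def real_distribution_axioms_def cantor_approx_def)
qed

lemma tight_cantor_approx: "tight (cantor_approx M A \<omega>)"
  unfolding tight_def
proof safe
  fix e :: real assume "e > 0"
  have "measure (cantor_approx M A \<omega> j) {-1<..1} = 1" for j
  proof -
    interpret real_distribution "cantor_approx M A \<omega> j" by (rule real_distribution_cantor_approx)
    have "AE x in cantor_approx M A \<omega> j. x \<in> {-1<..1}"
      unfolding cantor_approx_def using cantor_approx_set_subset
      by (subst AE_density) (fastforce simp: indicator_def)+
    then show ?thesis by (subst AE_in_set_eq_1[symmetric]) auto
  qed
  then show "\<exists>a b. a < b \<and> (\<forall>n. 1 - e < measure (cantor_approx M A \<omega> n) {a<..b})"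
    using \<open>e > 0\<close> by (intro exI[of _ "-1"] exI[of _ 1]) auto
qed (rule real_distribution_cantor_approx)

text \<open>After \<open>unit_char_mult\<close> both generations carry the same factor
  \<open>unit_char\<close> at the finer scale; what remains is the exponential sum over
  \<open>N (Suc j)\<close> minus its conditional mean.\<close>

lemma char_cantor_approx_Suc:
  "char (cantor_approx M A \<omega> (Suc j)) t - char (cantor_approx M A \<omega> j) t =
     deviation M A (N j) (\<omega> (Suc j)) (t / real M ^ Suc j) / of_real (real A ^ Suc j)
       * unit_char (t / real M ^ Suc j)"
proof -
  define s where "s = t / real M ^ Suc j"
  have s: "t / real M ^ j = real M * s" using M_pos by (simp add: s_def)
  have "deviation M A (N j) (\<omega> (Suc j)) s = (\<Sum>m\<in>N (Suc j). cis (real m * s))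
      - of_real (real A) * ((\<Sum>n\<in>N j. cis (real n * (real M * s))) * (\<Sum>a<M. cis (real a * s))) / of_real (real M)"
    unfolding deviation_def sum_N_Suc sum_product
    by (simp add: sum_subtractf sum_distrib_left[symmetric] sum_divide_distrib[symmetric]
        cis_mult ring_distribs mult_ac add.commute)
  note dev = this
  show ?thesis
    unfolding char_cantor_approx s unit_char_mult[OF M_pos] s_def[symmetric] dev using A_pos M_pos
    by (simp add: field_simps del: cantor_ints.simps)
qed

end

section \<open>Decay outside the large deviations\<close>

lemma sum_power_le_increasing:
  fixes r :: real
  assumes "r \<ge> 2"
  shows "(\<Sum>i<k. r ^ Suc i) \<le> 2 * r ^ k"
proof (induction k)
  case (Suc k)
  have "2 * r ^ k \<le> r * r ^ k" using assms by (intro mult_right_mono) auto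
  then show ?case using Suc by simp
qed simp

lemma sum_power_le_decreasing:
  fixes q :: real
  assumes "0 \<le> q" "q \<le> 1 / 2"
  shows "(\<Sum>i = k..<n. q ^ Suc i) \<le> 2 * q ^ Suc k"
proof (cases "k \<le> n")
  case True
  \<comment> \<open>The subtracted term strengthens the claim so that the induction on
    \<open>n\<close> closes.\<close>
  then have "(\<Sum>i = k..<n. q ^ Suc i) \<le> 2 * q ^ Suc k - 2 * q ^ Suc n"
  proof (induction n rule: dec_induct)
    case (step n)
    have "2 * q ^ Suc (Suc n) \<le> 1 * q ^ Suc n"
      using mult_right_mono[of "2 * q" 1 "q ^ Suc n"] assms by simp
    then show ?case using step by simp
  qed simp
  then show ?thesis using assms by (smt (verit) zero_le_power)
qed (use assms in simp)

lemma fourier_eq_char: "fourier \<nu> \<xi> = 1 / complex_of_real (sqrt (2 * pi)) * char \<nu> (- \<xi>)"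
  by (simp add: fourier_def char_def mult_ac)

context cantor_tree
begin

text \<open>The assumption on \<open>deviation\<close> is what holds off the exceptional events;
  \<open>q\<close> will be \<open>M powr (- \<alpha>)\<close>, the gain per generation.\<close>

context
  fixes q :: real
  assumes q: "0 \<le> q" "q \<le> 1 / 2"
    and dev: "\<And>j \<theta>. norm (deviation M A (N j) (\<omega> (Suc j)) \<theta>) \<le> 4 * q ^ Suc j * real A ^ Suc j"
begin

lemma char_cantor_approx_step:
  "norm (char (cantor_approx M A \<omega> (Suc j)) t - char (cantor_approx M A \<omega> j) t)
     \<le> 4 * q ^ Suc j * norm (unit_char (t / real M ^ Suc j))"
  unfolding char_cantor_approx_Suc norm_mult
  using dev[of j "t / real M ^ Suc j"] A_pos
  by (intro mult_right_mono) (auto simp: norm_divide norm_mult norm_power divide_le_eq)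

lemma convergent_char_cantor_approx: "convergent (\<lambda>j. char (cantor_approx M A \<omega> j) t)"
proof -
  let ?c = "\<lambda>j. char (cantor_approx M A \<omega> j) t"
  have "summable (\<lambda>j. ?c (Suc j) - ?c j)"
  proof (rule summable_comparison_test')
    show "summable (\<lambda>j. 4 * q * q ^ j)"
      using q by (intro summable_mult summable_geometric) auto
    fix j
    show "norm (?c (Suc j) - ?c j) \<le> 4 * q * q ^ j"
      using char_cantor_approx_step[of j t] q
        mult_left_mono[OF norm_unit_char_le_1[of "t / real M ^ Suc j"], of "4 * q ^ Suc j"]
      by (simp add: mult_ac)
  qed
  then have "convergent (\<lambda>n. (\<Sum>j<n. ?c (Suc j) - ?c j) + ?c 0)"
    by (intro convergent_add convergent_const) (simp add: summable_iff_convergent)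
  then show ?thesis by (subst (asm) sum_lessThan_telescope) simp
qed

text \<open>Shows that the definite description in \<open>cantor_measure\<close> denotes: the weak
  limit exists by tightness and summable increments, and it is unique by Levy's theorem.\<close>

lemma cantor_measure_props:
  "real_distribution (cantor_measure M A \<omega>)"
  "weak_conv_m (cantor_approx M A \<omega>) (cantor_measure M A \<omega>)"
proof -
  obtain \<nu> where \<nu>: "real_distribution \<nu>" "weak_conv_m (cantor_approx M A \<omega>) \<nu>"
    using tight_convergent_char_imp_weak_conv[OF tight_cantor_approx convergent_char_cantor_approx]
    by metis
  have "cantor_measure M A \<omega> = \<nu>"
    unfolding cantor_measure_def
  proof (rule the_equality)
    fix \<nu>' assume "real_distribution \<nu>' \<and> weak_conv_m (cantor_approx M A \<omega>) \<nu>'"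
    then show "\<nu>' = \<nu>"
      using weak_conv_m_unique[of "cantor_approx M A \<omega>" \<nu>' \<nu>] real_distribution_cantor_approx \<nu>
      by blast
  qed (use \<nu> in simp)
  with \<nu> show "real_distribution (cantor_measure M A \<omega>)"
    "weak_conv_m (cantor_approx M A \<omega>) (cantor_measure M A \<omega>)" by auto
qed

text \<open>For \<open>M ^ k \<le> \<bar>t\<bar> < M ^ Suc k\<close>, the increments up to generation \<open>k\<close> gain from the decay of
  \<^term>\<open>unit_char\<close>, and the later ones form a convergent geometric series.\<close>

lemma norm_char_cantor_approx_le:
  assumes q_def: "q = real M powr (- \<alpha>)" and \<alpha>: "0 < \<alpha>" "\<alpha> \<le> 1 / 2" and M: "M \<ge> 4" and t: "\<bar>t\<bar> \<ge> 1"
  shows "norm (char (cantor_approx M A \<omega> n) t) \<le> 26 * \<bar>t\<bar> powr (- \<alpha>)"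
proof -
  let ?c = "\<lambda>j. char (cantor_approx M A \<omega> j) t" and ?T = "\<bar>t\<bar>"
  define k where "k = nat \<lfloor>log (real M) ?T\<rfloor>"
  have k: "real k \<le> log (real M) ?T" "log (real M) ?T < real (Suc k)"
    using t M by (auto simp: k_def) linarith+
  have Mk: "real M ^ k \<le> ?T" "?T \<le> real M ^ Suc k"
    using k M t by (simp_all add: le_log_iff log_less_iff powr_realpow[symmetric] less_imp_le del: power_Suc)
  \<comment> \<open>The ratio at which the bounds for the early increments grow. As
    \<open>\<alpha> \<le> 1 / 2\<close> and \<open>M \<ge> 4\<close> it is at least 2, so the last
    of them dominates their sum.\<close>
  define r where "r = q * real M"
  have r_eq: "r = real M powr (1 - \<alpha>)"
    using M by (simp add: r_def q_def powr_diff powr_minus divide_inverse)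
  have r: "r \<ge> 2"
  proof -
    have "(2::real) = 4 powr (1 / 2)" by (simp add: powr_half_sqrt)
    also have "\<dots> \<le> real M powr (1 / 2)" using M by (intro powr_mono2) auto
    also have "\<dots> \<le> r" unfolding r_eq using \<alpha> M by (intro powr_mono) auto
    finally show ?thesis .
  qed
  have rk: "r ^ k \<le> ?T * ?T powr (- \<alpha>)"
  proof -
    have "r ^ k = (real M ^ k) powr (1 - \<alpha>)"
      using M by (simp add: r_eq powr_power powr_realpow[symmetric] powr_powr mult.commute)
    also have "\<dots> \<le> ?T powr (1 - \<alpha>)"
      using Mk \<alpha> by (intro powr_mono2) auto
    also have "\<dots> = ?T * ?T powr (- \<alpha>)"
      using t by (simp add: powr_diff powr_minus divide_inverse)
    finally show ?thesis .
  qed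
  have qk: "q ^ Suc k \<le> ?T powr (- \<alpha>)"
  proof -
    have "q ^ Suc k = (real M ^ Suc k) powr (- \<alpha>)"
      using M by (simp add: q_def powr_power powr_realpow[symmetric] powr_powr mult.commute del: power_Suc)
    also have "\<dots> \<le> ?T powr (- \<alpha>)"
      using Mk(2) \<alpha> t by (intro powr_mono2') auto
    finally show ?thesis .
  qed
  \<comment> \<open>Generation 0 is the uniform distribution on the unit interval, so only the decay
    of \<open>unit_char\<close> is at work.\<close>
  have init: "norm (?c 0) \<le> 2 * ?T powr (- \<alpha>)"
  proof -
    have "norm (?c 0) \<le> 2 / ?T"
      using norm_unit_char_le[of t] t by (simp add: char_cantor_approx)
    also have "\<dots> = 2 * ?T powr (-1)" using t by (simp add: powr_minus divide_inverse)
    also have "\<dots> \<le> 2 * ?T powr (- \<alpha>)" using t \<alpha> by (intro mult_left_mono powr_mono) auto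
    finally show ?thesis .
  qed
  have low: "norm (?c (Suc j) - ?c j) \<le> 8 / ?T * r ^ Suc j" for j
  proof -
    have "norm (unit_char (t / real M ^ Suc j)) \<le> 2 / \<bar>t / real M ^ Suc j\<bar>"
      using t M by (intro norm_unit_char_le) auto
    then have "norm (unit_char (t / real M ^ Suc j)) \<le> 2 * real M ^ Suc j / ?T"
      by (simp add: abs_divide)
    then have "4 * q ^ Suc j * norm (unit_char (t / real M ^ Suc j)) \<le> 4 * q ^ Suc j * (2 * real M ^ Suc j / ?T)"
      using q by (intro mult_left_mono) auto
    then show ?thesis
      using char_cantor_approx_step[of j t] by (simp add: r_def power_mult_distrib mult_ac)
  qed
  have high: "norm (?c (Suc j) - ?c j) \<le> 4 * q ^ Suc j" for j
    using char_cantor_approx_step[of j t] q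
        mult_left_mono[OF norm_unit_char_le_1[of "t / real M ^ Suc j"], of "4 * q ^ Suc j"]
    by simp
  have "(\<Sum>j<n. ?c (Suc j) - ?c j) = ?c n - ?c 0"
    by (rule sum_lessThan_telescope)
  then have "norm (?c n - ?c 0) \<le> (\<Sum>j<n. norm (?c (Suc j) - ?c j))"
    using norm_sum[of "\<lambda>j. ?c (Suc j) - ?c j" "{..<n}"] by simp
  \<comment> \<open>An inequality because \<open>n\<close> may be smaller than \<open>k\<close>; the
    added terms are nonnegative.\<close>
  also have "\<dots> \<le> (\<Sum>j\<in>{..<k} \<union> {k..<n}. norm (?c (Suc j) - ?c j))"
    by (intro sum_mono2) auto
  also have "\<dots> = (\<Sum>j<k. norm (?c (Suc j) - ?c j)) + (\<Sum>j = k..<n. norm (?c (Suc j) - ?c j))"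
    by (intro sum.union_disjoint) auto
  also have "\<dots> \<le> (\<Sum>j<k. 8 / ?T * r ^ Suc j) + (\<Sum>j = k..<n. 4 * q ^ Suc j)"
    by (intro add_mono sum_mono low high)
  also have "\<dots> = 8 / ?T * (\<Sum>j<k. r ^ Suc j) + 4 * (\<Sum>j = k..<n. q ^ Suc j)"
    by (simp only: sum_distrib_left)
  also have "\<dots> \<le> 8 / ?T * (2 * r ^ k) + 4 * (2 * q ^ Suc k)"
    using r q by (intro add_mono mult_left_mono sum_power_le_increasing sum_power_le_decreasing) auto
  also have "\<dots> \<le> 8 / ?T * (2 * (?T * ?T powr (- \<alpha>))) + 4 * (2 * ?T powr (- \<alpha>))"
    by (intro add_mono mult_left_mono rk qk) auto
  also have "\<dots> = 24 * ?T powr (- \<alpha>)"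
    using t by auto
  finally have "norm (?c n - ?c 0) \<le> 24 * ?T powr (- \<alpha>)" .
  then show ?thesis
    using init norm_triangle_sub[of "?c n" "?c 0"] by linarith
qed

lemma norm_fourier_cantor_measure_le:
  assumes "q = real M powr (- \<alpha>)" "0 < \<alpha>" "\<alpha> \<le> 1 / 2" "M \<ge> 4" "\<bar>\<xi>\<bar> \<ge> 1"
  shows "norm (fourier (cantor_measure M A \<omega>) \<xi>) \<le> 26 * \<bar>\<xi>\<bar> powr (- \<alpha>)"
proof -
  have "(\<lambda>n. char (cantor_approx M A \<omega> n) (- \<xi>)) \<longlonglongrightarrow> char (cantor_measure M A \<omega>) (- \<xi>)"
    by (rule levy_continuity1[OF real_distribution_cantor_approx cantor_measure_props])
  then have char: "norm (char (cantor_measure M A \<omega>) (- \<xi>)) \<le> 26 * \<bar>\<xi>\<bar> powr (- \<alpha>)"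
    by (rule Lim_bounded[OF tendsto_norm, where M = 0])
       (use norm_char_cantor_approx_le[of \<alpha> "- \<xi>"] assms in auto)
  have "norm (fourier (cantor_measure M A \<omega>) \<xi>) =
      norm (char (cantor_measure M A \<omega>) (- \<xi>)) / sqrt (2 * pi)"
    by (simp add: fourier_eq_char norm_mult norm_divide)
  also have "\<dots> \<le> norm (char (cantor_measure M A \<omega>) (- \<xi>)) / 1"
    using pi_ge_two by (intro divide_left_mono) auto
  finally show ?thesis using char by simp
qed

end

end

section \<open>Probability of the large deviations\<close>

lemma space_step_measure: "space (step_measure M A j) = alphabet_choices M A (A ^ (j - 1))"
  and sets_step_measure: "sets (step_measure M A j) = Pow (alphabet_choices M A (A ^ (j - 1)))"
  by (simp_all add: step_measure_def space_uniform_count_measure sets_uniform_count_measure)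

lemma alphabet_choices_nonempty:
  assumes "A \<le> M"
  shows "alphabet_choices M A n \<noteq> {}"
proof -
  have "{0..<A} \<in> alphabets M A" using assms by (auto simp: alphabets_def)
  then show ?thesis by (auto simp: PiE_eq_empty_iff)
qed

lemma prob_space_step_measure:
  assumes "A \<le> M"
  shows "prob_space (step_measure M A j)"
  unfolding step_measure_def
  by (intro prob_space_uniform_count_measure finite_alphabet_choices alphabet_choices_nonempty assms)

lemma prob_space_choice_measure:
  assumes "A \<le> M"
  shows "prob_space (choice_measure M A)"
  unfolding choice_measure_def by (intro prob_space_PiM prob_space_step_measure assms)

lemma space_choice_measure:
  "space (choice_measure M A) = (\<Pi>\<^sub>E j\<in>{1..}. alphabet_choices M A (A ^ (j - 1)))"
  by (simp add: choice_measure_def space_PiM space_step_measure)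

lemma cantor_tree_choice:
  assumes "\<omega> \<in> space (choice_measure M A)" "A > 0" "A \<le> M"
  shows "cantor_tree M A \<omega>"
proof
  fix j
  have "\<omega> (Suc j) \<in> alphabet_choices M A (A ^ (Suc j - 1))"
    using assms(1) unfolding space_choice_measure by (rule PiE_mem) simp
  then show "\<omega> (Suc j) \<in> alphabet_choices M A (A ^ j)" by simp
qed (use assms in auto)

text \<open>Each step has finitely many outcomes, so an event determined by the first
  \<open>j\<close> steps is a finite union of cylinders.\<close>

lemma sets_choice_measure_finite_dependence:
  assumes "\<And>\<omega> \<omega>'. (\<And>i. 1 \<le> i \<Longrightarrow> i \<le> j \<Longrightarrow> \<omega> i = \<omega>' i) \<Longrightarrow> P \<omega> \<longleftrightarrow> P \<omega>'"
  shows "{\<omega> \<in> space (choice_measure M A). P \<omega>} \<in> sets (choice_measure M A)"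
proof -
  let ?J = "{1..j}" and ?S = "\<lambda>i. alphabet_choices M A (A ^ (i - 1))"
  have restrict: "P (restrict \<omega> ?J) \<longleftrightarrow> P \<omega>" for \<omega>
    by (rule assms) auto
  let ?E = "{f \<in> PiE ?J ?S. P f}"
  have restrict_PiE: "restrict \<omega> ?J \<in> PiE ?J S" if "\<omega> \<in> PiE {1..} S"
    for \<omega> and S :: "nat \<Rightarrow> (nat \<Rightarrow> nat set) set"
    using that by (auto simp: PiE_iff)
  have "{\<omega> \<in> space (choice_measure M A). P \<omega>} =
      (\<Union>f\<in>?E. prod_emb {1..} (step_measure M A) ?J {f})"
    unfolding space_choice_measure prod_emb_def space_step_measure
    using restrict restrict_PiE[of _ ?S] by fastforce
  moreover have "prod_emb {1..} (step_measure M A) ?J {f} \<in> sets (choice_measure M A)" if "f \<in> ?E" for f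
  proof -
    have f: "f \<in> PiE ?J ?S" using that by blast
    then have "f \<in> extensional ?J" by (simp only: PiE_def Int_iff)
    then have "(\<Pi>\<^sub>E i\<in>?J. {f i}) = {f}" by (rule PiE_singleton)
    moreover have "prod_emb {1..} (step_measure M A) ?J (\<Pi>\<^sub>E i\<in>?J. {f i}) \<in> sets (choice_measure M A)"
      unfolding choice_measure_def
    proof (rule sets_PiM_I)
      show "\<forall>i\<in>?J. {f i} \<in> sets (step_measure M A i)"
        using PiE_mem[OF f] by (simp add: sets_step_measure)
    qed auto
    ultimately show ?thesis by simp
  qed
  moreover have "finite (PiE ?J ?S)" by (intro finite_PiE finite_alphabet_choices) auto
  ultimately show ?thesis by (simp only:) (intro sets.finite_UN, auto)
qed

text \<open>Fubini's theorem with coordinate \<open>j\<close> split off: a bound for the conditional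
  probability that is uniform in the other coordinates bounds the probability.\<close>

lemma emeasure_choice_measure_le:
  assumes "A \<le> M" and X: "X \<in> sets (choice_measure M A)" and j: "j \<ge> 1"
    and le: "\<And>w. w \<in> space (choice_measure M A) \<Longrightarrow>
       emeasure (step_measure M A j) {x \<in> space (step_measure M A j). w(j := x) \<in> X} \<le> c"
  shows "emeasure (choice_measure M A) X \<le> c"
proof -
  let ?S = "step_measure M A" and ?I = "{1..} - {j}"
  let ?R = "PiM ?I ?S" and ?f = "\<lambda>(x, w). w(j := x)"
  interpret S: prob_space "?S i" for i by (rule prob_space_step_measure[OF assms(1)])
  interpret R: prob_space ?R by (intro prob_space_PiM S.prob_space_axioms)
  interpret P: pair_sigma_finite "?S j" ?R ..
  have I: "insert j ?I = {1..}" using j by auto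
  have choice: "choice_measure M A = distr (?S j \<Otimes>\<^sub>M ?R) (choice_measure M A) ?f"
    using distr_pair_PiM_eq_PiM[of ?I ?S j] S.prob_space_axioms
    unfolding choice_measure_def I by simp
  have "?f \<in> ?S j \<Otimes>\<^sub>M ?R \<rightarrow>\<^sub>M PiM (insert j ?I) ?S"
    by measurable
  then have f: "?f \<in> ?S j \<Otimes>\<^sub>M ?R \<rightarrow>\<^sub>M choice_measure M A"
    unfolding choice_measure_def I .
  have "emeasure (choice_measure M A) X = emeasure (?S j \<Otimes>\<^sub>M ?R) (?f -` X \<inter> space (?S j \<Otimes>\<^sub>M ?R))"
    by (subst choice, rule emeasure_distr[OF f X])
  also have "\<dots> = (\<integral>\<^sup>+w. emeasure (?S j) ((\<lambda>x. (x, w)) -` (?f -` X \<inter> space (?S j \<Otimes>\<^sub>M ?R))) \<partial>?R)"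
    by (rule P.emeasure_pair_measure_alt2[OF measurable_sets[OF f X]])
  also have "\<dots> \<le> (\<integral>\<^sup>+w. c \<partial>?R)"
  proof (rule nn_integral_mono)
    fix w assume w: "w \<in> space ?R"
    \<comment> \<open>The point \<open>w\<close> lacks coordinate \<open>j\<close>; any filler makes
      it a point of the full space, and the update by \<open>x\<close> overwrites the
      filler.\<close>
    obtain x0 where x0: "x0 \<in> space (?S j)" using S.not_empty by blast
    have "w(j := x0) \<in> space (choice_measure M A)"
      using measurable_space[OF f, of "(x0, w)"] w x0 by (simp add: space_pair_measure)
    from le[OF this] have "emeasure (?S j) {x \<in> space (?S j). w(j := x) \<in> X} \<le> c" by simp
    also have "{x \<in> space (?S j). w(j := x) \<in> X} = (\<lambda>x. (x, w)) -` (?f -` X \<inter> space (?S j \<Otimes>\<^sub>M ?R))"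
      using w by (auto simp: space_pair_measure)
    finally show "emeasure (?S j) ((\<lambda>x. (x, w)) -` (?f -` X \<inter> space (?S j \<Otimes>\<^sub>M ?R))) \<le> c" .
  qed
  also have "\<dots> = c" by (simp only: nn_integral_const R.emeasure_space_1 mult_1_right)
  finally show ?thesis .
qed

definition large_deviation :: "nat \<Rightarrow> nat \<Rightarrow> nat \<Rightarrow> real \<Rightarrow> (nat \<Rightarrow> nat \<Rightarrow> nat set) set" where
  "large_deviation M A j t = {\<omega> \<in> space (choice_measure M A).
     \<exists>\<theta>. 4 * t * sqrt (real (A ^ Suc j)) < norm (deviation M A (cantor_ints M \<omega> j) (\<omega> (Suc j)) \<theta>)}"

lemma large_deviation_sets: "large_deviation M A j t \<in> sets (choice_measure M A)"
  unfolding large_deviation_def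
proof (rule sets_choice_measure_finite_dependence[of "Suc j"])
  fix \<omega> \<omega>' :: "nat \<Rightarrow> nat \<Rightarrow> nat set"
  assume eq: "\<And>i. 1 \<le> i \<Longrightarrow> i \<le> Suc j \<Longrightarrow> \<omega> i = \<omega>' i"
  have "cantor_ints M \<omega> j = cantor_ints M \<omega>' j" by (rule cantor_ints_cong) (simp add: eq)
  moreover have "\<omega> (Suc j) = \<omega>' (Suc j)" by (simp add: eq)
  ultimately show "(\<exists>\<theta>. 4 * t * sqrt (real (A ^ Suc j)) < norm (deviation M A (cantor_ints M \<omega> j) (\<omega> (Suc j)) \<theta>))
    \<longleftrightarrow> (\<exists>\<theta>. 4 * t * sqrt (real (A ^ Suc j)) < norm (deviation M A (cantor_ints M \<omega>' j) (\<omega>' (Suc j)) \<theta>))"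
    by simp
qed

text \<open>With all steps other than \<open>Suc j\<close> fixed, the set \<open>N j\<close> is
  fixed too, since it depends on earlier steps only. The conditional probability is then bounded by
  \<open>deviation_uniform_tail\<close> with \<open>L = M ^ j\<close>.\<close>

lemma measure_large_deviation_le:
  assumes A: "A > 0" "A \<le> M" and t: "t \<ge> 1"
  shows "measure (choice_measure M A) (large_deviation M A j t)
         \<le> 32 * (real M ^ Suc j)\<^sup>2 * exp (- t\<^sup>2 / 2)"
proof -
  let ?c = "32 * (real M ^ Suc j)\<^sup>2 * exp (- t\<^sup>2 / 2)" and ?\<Omega> = "alphabet_choices M A (A ^ j)"
  have "emeasure (choice_measure M A) (large_deviation M A j t) \<le> ennreal ?c"
  proof (rule emeasure_choice_measure_le[OF A(2) large_deviation_sets, of "Suc j"])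
    fix w assume w: "w \<in> space (choice_measure M A)"
    interpret cantor_tree M A w by (rule cantor_tree_choice[OF w A])
    have N: "N j \<noteq> {}" using card_N[of j] A by auto
    have "cantor_ints M (w(Suc j := x)) j = N j" for x
      by (rule cantor_ints_cong) auto
    then have "{x \<in> ?\<Omega>. w(Suc j := x) \<in> large_deviation M A j t} \<subseteq>
       {x \<in> ?\<Omega>. \<exists>\<theta>. 4 * t * sqrt (real (A ^ Suc j)) < norm (deviation M A (N j) x \<theta>)}"
      by (auto simp: large_deviation_def)
    then have "card {x \<in> ?\<Omega>. w(Suc j := x) \<in> large_deviation M A j t} \<le>
       card {x \<in> ?\<Omega>. \<exists>\<theta>. 4 * t * sqrt (real (A ^ Suc j)) < norm (deviation M A (N j) x \<theta>)}"
      by (intro card_mono) (auto simp: finite_alphabet_choices)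
    also have "real \<dots> \<le> ?c * real (card ?\<Omega>)"
      using deviation_uniform_tail[OF N N_subset t A] by (simp add: card_N mult.commute)
    finally have *: "real (card {x \<in> ?\<Omega>. w(Suc j := x) \<in> large_deviation M A j t}) \<le> ?c * real (card ?\<Omega>)"
      by simp
    have pos: "0 < card ?\<Omega>"
      using alphabet_choices_nonempty[OF A(2)] by (simp add: card_gt_0_iff finite_alphabet_choices)
    have "emeasure (step_measure M A (Suc j)) {x \<in> ?\<Omega>. w(Suc j := x) \<in> large_deviation M A j t} =
       ennreal (real (card {x \<in> ?\<Omega>. w(Suc j := x) \<in> large_deviation M A j t}) / real (card ?\<Omega>))"
      unfolding step_measure_def
      by (simp add: emeasure_uniform_count_measure finite_alphabet_choices)
    also have "\<dots> \<le> ennreal ?c"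
      using * pos by (intro ennreal_leI) (simp add: divide_le_eq)
    finally show "emeasure (step_measure M A (Suc j))
      {x \<in> space (step_measure M A (Suc j)). w(Suc j := x) \<in> large_deviation M A j t} \<le> ennreal ?c"
      by (simp add: space_step_measure)
  qed simp
  then show ?thesis unfolding measure_def by (intro enn2real_leI) auto
qed

section \<open>Summing the tail bounds over the generations\<close>

lemma power_le_fact_mult_exp:
  fixes y :: real
  assumes "y \<ge> 0"
  shows "y ^ n \<le> fact n * exp y"
proof -
  have "inverse (fact n) * y ^ n \<le> (\<Sum>k. inverse (fact k) * y ^ k)"
    using sum_le_suminf[OF summable_exp, of "{n}" y] assms by auto
  then show ?thesis by (simp add: exp_def scaleR_conv_of_real field_simps)
qed

text \<open>The exponent \<open>n\<close> is large enough that the \<open>n\<close>-th power of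
  \<open>x powr \<epsilon>\<close> dominates \<open>x ^ 3\<close> when \<open>x \<ge> 1\<close> and
  \<open>\<epsilon> > 0\<close>.\<close>

definition decay_const :: "real \<Rightarrow> real" where
  "decay_const \<epsilon> = (let n = nat \<lceil>3 / \<epsilon>\<rceil> in 4 ^ n * fact n)"

lemma decay_const_pos: "decay_const \<epsilon> > 0"
  by (simp add: decay_const_def Let_def)

lemma cube_mult_exp_le:
  fixes x :: real
  assumes "x \<ge> 1" "\<epsilon> > 0"
  shows "x ^ 3 * exp (- (x powr \<epsilon>) / 4) \<le> decay_const \<epsilon>"
proof -
  define n where "n = nat \<lceil>3 / \<epsilon>\<rceil>"
  have "3 / \<epsilon> \<le> real n" unfolding n_def by (rule real_nat_ceiling_ge)
  then have n: "3 \<le> \<epsilon> * real n" using assms by (simp add: divide_le_eq mult.commute)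
  have "x ^ 3 = x powr 3" using assms by simp
  also have "\<dots> \<le> x powr (\<epsilon> * real n)" using n assms by (intro powr_mono) auto
  also have "\<dots> = 4 ^ n * (x powr \<epsilon> / 4) ^ n"
    using assms by (simp add: powr_power power_divide mult.commute)
  also have "\<dots> \<le> 4 ^ n * (fact n * exp (x powr \<epsilon> / 4))"
    by (intro mult_left_mono power_le_fact_mult_exp) auto
  finally show ?thesis by (simp add: decay_const_def n_def Let_def exp_minus field_simps)
qed

text \<open>With \<open>x = M ^ Suc j\<close>, write \<open>x\<^sup>2\<close> as
  \<open>x ^ 3 / x\<close> and halve the exponent. One exponential absorbs \<open>x ^ 3\<close>, the
  other is largest at \<open>x = M\<close> and gives the final probability, and \<open>1 / x\<close>
  is summable over \<open>j\<close>.\<close>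

lemma large_deviation_bound_le:
  assumes M: "M \<ge> 2" and "\<epsilon> > 0"
  shows "32 * (real M ^ Suc j)\<^sup>2 * exp (- ((real M ^ Suc j) powr \<epsilon>) / 2)
         \<le> 32 * decay_const \<epsilon> * exp (- (real M powr \<epsilon>) / 4) * (1 / 2) ^ Suc j"
proof -
  define x where "x = real M ^ Suc j"
  have x1: "x \<ge> 1" using M by (simp add: x_def one_le_power del: power_Suc)
  have xM: "x \<ge> real M" using M by (simp add: x_def self_le_power del: power_Suc)
  have x2: "2 ^ Suc j \<le> x" unfolding x_def using M by (intro power_mono) auto
  have "x\<^sup>2 * exp (- (x powr \<epsilon>) / 2) = (x ^ 3 * exp (- (x powr \<epsilon>) / 4)) * exp (- (x powr \<epsilon>) / 4) * (1 / x)"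
  proof -
    have "exp (- (x powr \<epsilon>) / 2) = exp (- (x powr \<epsilon>) / 4) * exp (- (x powr \<epsilon>) / 4)"
      by (simp add: exp_add[symmetric])
    then show ?thesis using x1 by (simp add: power3_eq_cube power2_eq_square)
  qed
  also have "\<dots> \<le> decay_const \<epsilon> * exp (- (real M powr \<epsilon>) / 4) * (1 / 2 ^ Suc j)"
  proof (intro mult_mono cube_mult_exp_le assms x1)
    show "exp (- (x powr \<epsilon>) / 4) \<le> exp (- (real M powr \<epsilon>) / 4)"
      using xM assms by (simp add: powr_mono2)
    show "1 / x \<le> 1 / 2 ^ Suc j" using x1 x2 by (intro divide_left_mono) auto
  qed (use x1 decay_const_pos[of \<epsilon>] in \<open>auto simp: less_imp_le\<close>)
  finally show ?thesis by (simp add: x_def power_one_over mult.assoc)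
qed

theorem theorem1p5:
  shows "\<exists>(C::real) (C1::real \<Rightarrow> real). C > 0 \<and> (\<forall>\<epsilon>. C1 \<epsilon> > 0) \<and>
    (\<forall>(\<delta>::real) (M::nat) (A::nat).
       0 < \<delta> \<and> \<delta> < 1 \<and> real M \<ge> 2 powr (4 / \<delta>) \<and> real A = real M powr \<delta> \<longrightarrow>
       (\<forall>\<epsilon>::real. 0 < \<epsilon> \<and> \<epsilon> < min (\<delta> / 2) (1 / 3) \<longrightarrow>
          (\<exists>G \<in> sets (choice_measure M A).
             measure (choice_measure M A) (space (choice_measure M A) - G)
               \<le> C1 \<epsilon> * exp (- (real M powr \<epsilon>) / C) \<and>
             (\<forall>\<omega>\<in>G. \<forall>\<xi>::real. \<bar>\<xi>\<bar> \<ge> real M ^ 4 \<longrightarrow>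
                norm (fourier (cantor_measure M A \<omega>) \<xi>)
                  \<le> C * \<bar>\<xi>\<bar> powr (- ((\<delta> - \<epsilon>) / 2))))))"
\<comment> \<open>The 26 is the constant of the decay bound. The probability bound is obtained with
  4 in the exponent, and 26 is weaker there.\<close>
proof (rule exI[of _ 26], rule exI[of _ "\<lambda>\<epsilon>. 32 * decay_const \<epsilon>"], intro conjI allI impI)
  fix \<epsilon> show "32 * decay_const \<epsilon> > 0" by (simp add: decay_const_pos)
next
  fix \<delta> \<epsilon> :: real and M A :: nat
  assume "0 < \<delta> \<and> \<delta> < 1 \<and> real M \<ge> 2 powr (4 / \<delta>) \<and> real A = real M powr \<delta>"
    and "0 < \<epsilon> \<and> \<epsilon> < min (\<delta> / 2) (1 / 3)"
  then have \<delta>: "0 < \<delta>" "\<delta> < 1" and M2: "real M \<ge> 2 powr (4 / \<delta>)" and A_eq: "real A = real M powr \<delta>"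
    and \<epsilon>: "0 < \<epsilon>" "\<epsilon> < \<delta> / 2" by auto
  have "2 powr 4 \<le> (2::real) powr (4 / \<delta>)" using \<delta> by (intro powr_mono) (auto simp: le_divide_eq)
  then have M: "M \<ge> 16" using M2 by simp
  have A: "A > 0" "A \<le> M"
  proof -
    have "real A > 0" unfolding A_eq using M by simp
    then show "A > 0" by simp
    have "real A \<le> real M powr 1" unfolding A_eq using M \<delta> by (intro powr_mono) auto
    then show "A \<le> M" using M by simp
  qed
  define \<alpha> where "\<alpha> = (\<delta> - \<epsilon>) / 2"
  define q where "q = real M powr (- \<alpha>)"
  have \<alpha>: "0 < \<alpha>" "\<alpha> \<le> 1 / 2" "\<delta> / 4 \<le> \<alpha>" using \<delta> \<epsilon> by (auto simp: \<alpha>_def)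
  \<comment> \<open>Here the lower bound on \<open>M\<close> enters: since
    \<open>\<epsilon> < \<delta> / 2\<close> gives \<open>\<alpha> \<ge> \<delta> / 4\<close>, the
    power \<open>4 / \<delta>\<close> of 2 yields a ratio of at most one half.\<close>
  have q: "0 \<le> q" "q \<le> 1 / 2"
  proof -
    have "q \<le> real M powr (- (\<delta> / 4))" unfolding q_def using \<alpha> M by (intro powr_mono) auto
    also have "\<dots> \<le> (2 powr (4 / \<delta>)) powr (- (\<delta> / 4))" using M2 \<delta> by (intro powr_mono2') auto
    also have "\<dots> = 1 / 2" using \<delta> by (simp add: powr_powr powr_minus)
    finally show "q \<le> 1 / 2" .
  qed (simp add: q_def)
  \<comment> \<open>Chosen so that \<open>(t j)\<^sup>2\<close> is
    \<open>(M ^ Suc j) powr \<epsilon>\<close>, which makes the tails summable, while the threshold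
    relative to \<open>A ^ Suc j\<close> points is still \<open>q ^ Suc j\<close> up to a
    constant.\<close>
  define t where "t j = real M powr (\<epsilon> * real (Suc j) / 2)" for j
  have t1: "t j \<ge> 1" for j using M \<epsilon> by (simp add: t_def ge_one_powr_ge_zero)
  have t2: "(t j)\<^sup>2 = (real M ^ Suc j) powr \<epsilon>" for j
    using M by (simp add: t_def powr_power powr_realpow[symmetric] powr_powr mult.commute del: power_Suc)
  have tq: "t j * sqrt (real (A ^ Suc j)) = q ^ Suc j * real A ^ Suc j" for j
  proof -
    have "sqrt (real (A ^ Suc j)) = (real M powr (\<delta> * real (Suc j))) powr (1 / 2)"
      using M by (simp add: A_eq powr_power powr_half_sqrt mult.commute del: power_Suc)
    then have "t j * sqrt (real (A ^ Suc j)) = real M powr (\<epsilon> * real (Suc j) / 2 + \<delta> * real (Suc j) / 2)"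
      by (simp add: t_def powr_powr powr_add)
    also have "\<epsilon> * real (Suc j) / 2 + \<delta> * real (Suc j) / 2 = - \<alpha> * real (Suc j) + \<delta> * real (Suc j)"
      unfolding \<alpha>_def by (simp add: field_simps)
    also have "real M powr \<dots> = real M powr (- \<alpha> * real (Suc j)) * real M powr (\<delta> * real (Suc j))"
      by (rule powr_add)
    also have "\<dots> = q ^ Suc j * real A ^ Suc j"
      using M by (simp add: q_def A_eq powr_power mult.commute del: power_Suc of_nat_Suc)
    finally show ?thesis .
  qed
  interpret prob_space "choice_measure M A" by (rule prob_space_choice_measure[OF A(2)])
  define B where "B j = large_deviation M A j (t j)" for j
  have B: "B j \<in> sets (choice_measure M A)" for j by (simp add: B_def large_deviation_sets)
  let ?c = "32 * decay_const \<epsilon> * exp (- (real M powr \<epsilon>) / 4)"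
  have PB: "prob (B j) \<le> ?c * (1 / 2) ^ Suc j" for j
  proof -
    have "prob (B j) \<le> 32 * (real M ^ Suc j)\<^sup>2 * exp (- (t j)\<^sup>2 / 2)"
      unfolding B_def by (rule measure_large_deviation_le[OF A t1])
    also have "\<dots> \<le> ?c * (1 / 2) ^ Suc j"
      unfolding t2 using large_deviation_bound_le[of M \<epsilon> j] M \<epsilon> by simp
    finally show ?thesis .
  qed
  have half: "(\<lambda>j. ?c * (1 / 2) ^ Suc j) sums ?c"
    using sums_mult[OF power_half_series, of ?c] by simp
  have sumB: "summable (\<lambda>j. prob (B j))"
    by (rule summable_comparison_test'[OF sums_summable[OF half], of 0]) (use PB in simp)
  have "prob (\<Union>j. B j) \<le> (\<Sum>j. prob (B j))"
    by (rule finite_measure_subadditive_countably) (use B sumB in auto)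
  also have "\<dots> \<le> ?c"
    using suminf_le[OF PB sumB sums_summable[OF half]] sums_unique[OF half] by simp
  also have "\<dots> \<le> 32 * decay_const \<epsilon> * exp (- (real M powr \<epsilon>) / 26)"
    using decay_const_pos[of \<epsilon>] by simp
  finally have PG: "prob (\<Union>j. B j) \<le> 32 * decay_const \<epsilon> * exp (- (real M powr \<epsilon>) / 26)" .
  show "\<exists>G \<in> sets (choice_measure M A).
             measure (choice_measure M A) (space (choice_measure M A) - G)
               \<le> 32 * decay_const \<epsilon> * exp (- (real M powr \<epsilon>) / 26) \<and>
             (\<forall>\<omega>\<in>G. \<forall>\<xi>::real. \<bar>\<xi>\<bar> \<ge> real M ^ 4 \<longrightarrow>
                norm (fourier (cantor_measure M A \<omega>) \<xi>)
                  \<le> 26 * \<bar>\<xi>\<bar> powr (- ((\<delta> - \<epsilon>) / 2)))"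
  proof (intro bexI conjI ballI allI impI)
    \<comment> \<open>The good set is the complement of all exceptional events.\<close>
    show "space (choice_measure M A) - (\<Union>j. B j) \<in> events" using B by auto
    have "space (choice_measure M A) - (space (choice_measure M A) - (\<Union>j. B j)) = (\<Union>j. B j)"
      using sets.sets_into_space[OF B] by blast
    then show "prob (space (choice_measure M A) - (space (choice_measure M A) - (\<Union>j. B j)))
        \<le> 32 * decay_const \<epsilon> * exp (- (real M powr \<epsilon>) / 26)" using PG by simp
    fix \<omega> \<xi> assume \<omega>: "\<omega> \<in> space (choice_measure M A) - (\<Union>j. B j)" and \<xi>: "\<bar>\<xi>\<bar> \<ge> real M ^ 4"
    interpret cantor_tree M A \<omega> using \<omega> by (intro cantor_tree_choice A) auto
    have dev: "norm (deviation M A (N j) (\<omega> (Suc j)) \<theta>) \<le> 4 * q ^ Suc j * real A ^ Suc j" for j \<theta>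
    proof -
      have "\<omega> \<notin> B j" using \<omega> by blast
      then have "norm (deviation M A (N j) (\<omega> (Suc j)) \<theta>) \<le> 4 * (t j * sqrt (real (A ^ Suc j)))"
        using \<omega> by (simp add: B_def large_deviation_def not_less mult.assoc)
      then show ?thesis unfolding tq by (simp add: mult.assoc)
    qed
    have "1 \<le> real M ^ 4" using M by (intro one_le_power) auto
    with \<xi> have "1 \<le> \<bar>\<xi>\<bar>" by linarith
    then show "norm (fourier (cantor_measure M A \<omega>) \<xi>) \<le> 26 * \<bar>\<xi>\<bar> powr (- ((\<delta> - \<epsilon>) / 2))"
      using norm_fourier_cantor_measure_le[OF q dev q_def \<alpha>(1,2)] M by (simp add: \<alpha>_def)
  qed
qed simp

end
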